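(* Compare fixed quiet and event sets with finite moments, in the regimes (I), (C), (S) described in the context. Let $V_t$ be the trace of the unstabilized twin's conditional covariance given $\mathcal F_{t-1}$ and suppose $$\Delta V:=\mathbb E[V_t\mid\mathrm{event}]-\mathbb E[V_t\mid\mathrm{quiet}]>0 .$$ In (C), assume the external and body channels are conditionally independent given $\mathcal F_{t-1}$ and that their event-minus-quiet trace-variance increments sum to a positive value. Then: **(i)** Each uncorrected regime ((I) or (C)) is its own twin, so its variance increment and its defined kurtosis increments equal the corresponding twin increments; in particular $\Delta H=\Delta H^{\mathrm{pass}}>0$. **(ii)** In any conditioning set in which a fixed scalar projection of the body and external channels gives independent centered variables with positive variances and finite fourth moments, (C) has $$\kappa_C=w_b^2\kappa_b+w_e^2\kappa_e,$$ where $\kappa_b,\kappa_e$ are the excess kurtoses of the projected body and external channels and $w_b,w_e$ (with $w_b+w_e=1$) are their shares of the total variance. When the component channels are independent within each of the event and quiet window laws, the event-minus-quiet excess-kurtosis increment of (C) is positive if and only if this weighted sum is larger for the event law than for the quiet law. For averages of conditional kurtoses, the entire weighted expression is averaged in each window instead. (Event amplification alone is not claimed to establish either inequality.) If moreover, in the same conditioning set, the external component of (C) has the same standardized law as the inert channel (so $\kappa_e=\kappa_I$), $\kappa_I\ge0$, and $\kappa_b\le\kappa_I$, then $\kappa_C\le\kappa_I$. **(iii)** In the linear (S) model with constant $\lambda\in[0,1]$, constant noise covariance $F_\nu$, conditional independence of $\boldsymbol\zeta_t$ and $\boldsymbol\nu_t$, and $K_t=0$ in quiet windows: if $\lambda>0$,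 $$\Delta H\le(1-\lambda)^2\Delta V<\Delta V .$$ If $\lambda=0$, then $\Delta H<\Delta V$ holds exactly when $\mathbb E[(1-(1-K_t)^2)V_t\mid\mathrm{event}]>0$. If instead the same constant gain $K\in[0,1)$ applies in both windows, then $$\Delta H=(1-K)^2(1-\lambda)^2\Delta V,$$ which is strictly below $\Delta V$ when $K>0$ or $\lambda>0$. For shape, fix a conditional history or a window law under which the scalar projections $Z$ of $\boldsymbol\zeta_t$ and $N$ of $\boldsymbol\nu_t$ are centered and independent with positive finite variances and finite fourth moments, and let $R=(1-\lambda)Z+\lambda N$ and $$w=\frac{(1-\lambda)^2\operatorname{Var}(Z)}{(1-\lambda)^2\operatorname{Var}(Z)+\lambda^2\operatorname{Var}(N)} .$$ If $\kappa_Z>0$, $\kappa_N=0$ and $0<\lambda<1$, then $0<\kappa_R=w^2\kappa_Z<\kappa_Z$. Predictable recovery scaling (multiplication by $1-K_t>0$) preserves this ordering of conditional excess kurtoses given $\mathcal F_{t-1}$ (no assertion is made for pooled window kurtosis). At $\lambda=0$ the twin shape is unchanged ($\kappa_R=\kappa_Z$); at $\lambda=1$ the floor shape is attained ($\kappa_R=\kappa_N$).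
   Context: $\mathcal F_t$ is the information through step $t$; "predictable" means $\mathcal F_{t-1}$-measurable. The velocity innovation $\boldsymbol\varepsilon_t$ (a random vector) is conditionally centered given $\mathcal F_{t-1}$ and $H_t=\operatorname{Var}(\boldsymbol\varepsilon_t\mid\mathcal F_{t-1})$. Regimes: - (I) inert: no correction and no body-generated pulses; a single external channel. - (C) impulsively forced: no correction; $\boldsymbol\varepsilon_t=\boldsymbol\zeta^e_t+\boldsymbol\zeta^b_t$ with external channel $\boldsymbol\zeta^e_t$ and body channel $\boldsymbol\zeta^b_t$, both conditionally centered. - (S) stabilized, linear law: $\boldsymbol\varepsilon_t=(1-K_t)\mathbf r_t$, $\mathbf r_t=(1-\lambda)\boldsymbol\zeta_t+\lambda\boldsymbol\nu_t$, where, given $\mathcal F_{t-1}$, the disturbance $\boldsymbol\zeta_t$ and the sensing-and-actuation noise ("floor") $\boldsymbol\nu_t$ are centered and independent with finite covariance; $\lambda\in[0,1]$ and $F_\nu=\operatorname{Var}(\boldsymbol\nu_t\mid\mathcal F_{t-1})$ are constant over compared windows; the recovery gain $K_t$ is predictable with $0\le K_t\le K_{\max}<1$. The quiet covariance of $\mathbf r_t$ is positive definite. The unstabilized twin of a regime has the same forcing with correction removed (its innovation is $\boldsymbol\zeta_t$ in (S), and $\boldsymbol\varepsilon_t$ itself in (I) and (C)); superscript "pass" denotes twin quantities. $\mathbb E[\cdot\mid\mathrm{event}]$ and $\mathbb E[\cdot\mid\mathrm{quiet}]$ are averages over the fixed event and quiet sets, and $\Delta H=\mathbb E[\operatorname{tr}H_t\mid\mathrm{event}]-\mathbb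 E[\operatorname{tr}H_t\mid\mathrm{quiet}]$; $\Delta H^{\mathrm{pass}}$ is the same for the twin (thus $\Delta H^{\mathrm{pass}}=\Delta V$). The excess kurtosis of a scalar $X$ with positive variance and finite fourth moment is $\kappa_X=\mathbb E[(X-\mathbb EX)^4]/\operatorname{Var}(X)^2-3$, computed in the law under consideration; $\kappa_C,\kappa_I$ are those of a fixed scalar projection of the innovation in (C), (I). *)

theory Defs
  imports "HOL-Probability.Probability"
begin

subsection \<open>Conditional moments given a sub-sigma-algebra\<close>

definition cond_mean ::
    "'a measure \<Rightarrow> 'a measure \<Rightarrow> ('a \<Rightarrow> real^'n) \<Rightarrow> 'a \<Rightarrow> real^'n" where
  "cond_mean M G X \<omega> = (\<chi> i. real_cond_exp M G (\<lambda>x. X x $ i) \<omega>)"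

definition cond_cov ::
    "'a measure \<Rightarrow> 'a measure \<Rightarrow> ('a \<Rightarrow> real^'n) \<Rightarrow> 'a \<Rightarrow> real^'n^'n" where
  "cond_cov M G X \<omega> =
    (\<chi> i j. real_cond_exp M G
       (\<lambda>x. (X x $ i - cond_mean M G X x $ i) * (X x $ j - cond_mean M G X x $ j)) \<omega>)"

text \<open>Finiteness is asked of the conditional moments only, almost surely, not of the
  unconditional ones. It has to be stated with \<^const>\<open>nn_cond_exp\<close>, because
  \<^const>\<open>real_cond_exp\<close> replaces an infinite positive or negative part by 0.\<close>

definition cond_centered ::
    "'a measure \<Rightarrow> 'a measure \<Rightarrow> ('a \<Rightarrow> real^'n) \<Rightarrow> bool" where
  "cond_centered M G X \<longleftrightarrow>
     X \<in> borel_measurable M \<and>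
     (AE \<omega> in M. nn_cond_exp M G (\<lambda>x. ennreal (norm (X x))) \<omega> < \<infinity>) \<and>
     (AE \<omega> in M. cond_mean M G X \<omega> = 0)"

definition cond_finite_cov ::
    "'a measure \<Rightarrow> 'a measure \<Rightarrow> ('a \<Rightarrow> real^'n) \<Rightarrow> bool" where
  "cond_finite_cov M G X \<longleftrightarrow>
     (AE \<omega> in M. nn_cond_exp M G (\<lambda>x. ennreal ((norm (X x))\<^sup>2)) \<omega> < \<infinity>)"

definition cond_prob_given :: "'a measure \<Rightarrow> 'a measure \<Rightarrow> 'a set \<Rightarrow> 'a \<Rightarrow> real" where
  "cond_prob_given M G A = real_cond_exp M G (indicator A)"

definition cond_indep ::
    "'a measure \<Rightarrow> 'a measure \<Rightarrow> ('a \<Rightarrow> real^'n) \<Rightarrow> ('a \<Rightarrow> real^'n) \<Rightarrow> bool" where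
  "cond_indep M G X Y \<longleftrightarrow>
     (\<forall>A\<in>sets borel. \<forall>B\<in>sets borel. AE \<omega> in M.
        cond_prob_given M G {x \<in> space M. X x \<in> A \<and> Y x \<in> B} \<omega> =
        cond_prob_given M G {x \<in> space M. X x \<in> A} \<omega> *
        cond_prob_given M G {x \<in> space M. Y x \<in> B} \<omega>)"

definition cond_var ::
    "'a measure \<Rightarrow> 'a measure \<Rightarrow> ('a \<Rightarrow> real) \<Rightarrow> 'a \<Rightarrow> real" where
  "cond_var M G X = real_cond_exp M G (\<lambda>x. (X x - real_cond_exp M G X x)\<^sup>2)"

definition cond_kurt ::
    "'a measure \<Rightarrow> 'a measure \<Rightarrow> ('a \<Rightarrow> real) \<Rightarrow> 'a \<Rightarrow> real" where
  "cond_kurt M G X \<omega> =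
     real_cond_exp M G (\<lambda>x. (X x - real_cond_exp M G X x) ^ 4) \<omega> / (cond_var M G X \<omega>)\<^sup>2 - 3"

text \<open>The conditional kurtosis of \<open>X\<close> is defined at the history \<open>\<omega>\<close>.\<close>

definition cond_kurt_defined ::
    "'a measure \<Rightarrow> 'a measure \<Rightarrow> ('a \<Rightarrow> real) \<Rightarrow> 'a \<Rightarrow> bool" where
  "cond_kurt_defined M G X \<omega> \<longleftrightarrow>
     0 < cond_var M G X \<omega> \<and> nn_cond_exp M G (\<lambda>x. ennreal (X x ^ 4)) \<omega> < \<infinity>"

definition cond_share ::
    "'a measure \<Rightarrow> 'a measure \<Rightarrow> ('a \<Rightarrow> real) \<Rightarrow> ('a \<Rightarrow> real) \<Rightarrow> 'a \<Rightarrow> real" where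
  "cond_share M G X Y \<omega> = cond_var M G X \<omega> / cond_var M G (\<lambda>x. X x + Y x) \<omega>"

definition cond_weighted_kurt ::
    "'a measure \<Rightarrow> 'a measure \<Rightarrow> ('a \<Rightarrow> real) \<Rightarrow> ('a \<Rightarrow> real) \<Rightarrow> 'a \<Rightarrow> real" where
  "cond_weighted_kurt M G X Y \<omega> =
     (cond_share M G X Y \<omega>)\<^sup>2 * cond_kurt M G X \<omega> + (cond_share M G Y X \<omega>)\<^sup>2 * cond_kurt M G Y \<omega>"

definition cond_standardize ::
    "'a measure \<Rightarrow> 'a measure \<Rightarrow> ('a \<Rightarrow> real) \<Rightarrow> 'a \<Rightarrow> real" where
  "cond_standardize M G X \<omega> = (X \<omega> - real_cond_exp M G X \<omega>) / sqrt (cond_var M G X \<omega>)"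

text \<open>Equality of the conditional standardized laws at almost every history in \<open>A\<close>.\<close>

definition cond_same_std_law ::
    "'a measure \<Rightarrow> 'a measure \<Rightarrow> 'a set \<Rightarrow> ('a \<Rightarrow> real) \<Rightarrow> ('a \<Rightarrow> real) \<Rightarrow> bool" where
  "cond_same_std_law M G A X Y \<longleftrightarrow>
     (\<forall>B\<in>sets borel. AE \<omega> in M. \<omega> \<in> A \<longrightarrow>
        cond_prob_given M G {x \<in> space M. cond_standardize M G X x \<in> B} \<omega> =
        cond_prob_given M G {x \<in> space M. cond_standardize M G Y x \<in> B} \<omega>)"


subsection \<open>Windows and their laws\<close>

text \<open>An event or quiet set consists of pairs of a step and an outcome, so that fixed ranges of
  steps, random events at a given step and mixtures of both are covered. Averaging over it is
  integration against its normalized (counting times probability) measure. Step 0 carries only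
  the initial information \<open>F 0\<close>; innovations start at step 1.\<close>

definition window :: "'a measure \<Rightarrow> (nat \<times> 'a) set \<Rightarrow> bool" where
  "window M W \<longleftrightarrow>
     W \<in> sets (count_space {1..} \<Otimes>\<^sub>M M) \<and>
     0 < emeasure (count_space {1..} \<Otimes>\<^sub>M M) W \<and> emeasure (count_space {1..} \<Otimes>\<^sub>M M) W < \<infinity>"

definition window_law :: "'a measure \<Rightarrow> (nat \<times> 'a) set \<Rightarrow> (nat \<times> 'a) measure" where
  "window_law M W = uniform_measure (count_space {1..} \<Otimes>\<^sub>M M) W"

definition window_avg ::
    "'a measure \<Rightarrow> (nat \<times> 'a) set \<Rightarrow> (nat \<Rightarrow> 'a \<Rightarrow> real) \<Rightarrow> real" where
  "window_avg M W f = (LINT p|window_law M W. f (fst p) (snd p))"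

definition window_integrable ::
    "'a measure \<Rightarrow> (nat \<times> 'a) set \<Rightarrow> (nat \<Rightarrow> 'a \<Rightarrow> real) \<Rightarrow> bool" where
  "window_integrable M W f \<longleftrightarrow> integrable (window_law M W) (\<lambda>p. f (fst p) (snd p))"

definition scalar_proj :: "real^'n \<Rightarrow> (nat \<Rightarrow> 'a \<Rightarrow> real^'n) \<Rightarrow> nat \<Rightarrow> 'a \<Rightarrow> real" where
  "scalar_proj u X t \<omega> = u \<bullet> X t \<omega>"

definition pooled_proj :: "real^'n \<Rightarrow> (nat \<Rightarrow> 'a \<Rightarrow> real^'n) \<Rightarrow> nat \<times> 'a \<Rightarrow> real" where
  "pooled_proj u X p = u \<bullet> X (fst p) (snd p)"


subsection \<open>Kurtosis under a law\<close>

definition law_var :: "'b measure \<Rightarrow> ('b \<Rightarrow> real) \<Rightarrow> real" where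
  "law_var Q X = (LINT x|Q. (X x - (LINT y|Q. X y))\<^sup>2)"

definition kurt :: "'b measure \<Rightarrow> ('b \<Rightarrow> real) \<Rightarrow> real" where
  "kurt Q X = (LINT x|Q. (X x - (LINT y|Q. X y)) ^ 4) / (law_var Q X)\<^sup>2 - 3"

definition kurt_defined :: "'b measure \<Rightarrow> ('b \<Rightarrow> real) \<Rightarrow> bool" where
  "kurt_defined Q X \<longleftrightarrow>
     X \<in> borel_measurable Q \<and> integrable Q (\<lambda>x. X x ^ 4) \<and> 0 < law_var Q X"

definition indep_centered :: "'b measure \<Rightarrow> ('b \<Rightarrow> real) \<Rightarrow> ('b \<Rightarrow> real) \<Rightarrow> bool" where
  "indep_centered Q X Y \<longleftrightarrow>
     kurt_defined Q X \<and> kurt_defined Q Y \<and> (LINT x|Q. X x) = 0 \<and> (LINT x|Q. Y x) = 0 \<and>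
     prob_space.indep_var Q borel X borel Y"

definition share :: "'b measure \<Rightarrow> ('b \<Rightarrow> real) \<Rightarrow> ('b \<Rightarrow> real) \<Rightarrow> real" where
  "share Q X Y = law_var Q X / law_var Q (\<lambda>x. X x + Y x)"

definition weighted_kurt :: "'b measure \<Rightarrow> ('b \<Rightarrow> real) \<Rightarrow> ('b \<Rightarrow> real) \<Rightarrow> real" where
  "weighted_kurt Q X Y = (share Q X Y)\<^sup>2 * kurt Q X + (share Q Y X)\<^sup>2 * kurt Q Y"

definition standardize :: "'b measure \<Rightarrow> ('b \<Rightarrow> real) \<Rightarrow> 'b \<Rightarrow> real" where
  "standardize Q X x = (X x - (LINT y|Q. X y)) / sqrt (law_var Q X)"

definition same_std_law :: "'b measure \<Rightarrow> ('b \<Rightarrow> real) \<Rightarrow> ('b \<Rightarrow> real) \<Rightarrow> bool" where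
  "same_std_law Q X Y \<longleftrightarrow> distr Q borel (standardize Q X) = distr Q borel (standardize Q Y)"


subsection \<open>Regimes\<close>

text \<open>\<open>Inert \<zeta>\<^sub>e\<close>, \<open>Forced \<zeta>\<^sub>e \<zeta>\<^sub>b\<close> (external, body) and \<open>Stabilized \<lambda> \<zeta> \<nu> K\<close>
  (floor weight, disturbance, floor, gain).\<close>

datatype ('a, 'n::finite) regime =
    Inert "nat \<Rightarrow> 'a \<Rightarrow> real^'n"
  | Forced "nat \<Rightarrow> 'a \<Rightarrow> real^'n" "nat \<Rightarrow> 'a \<Rightarrow> real^'n"
  | Stabilized real "nat \<Rightarrow> 'a \<Rightarrow> real^'n" "nat \<Rightarrow> 'a \<Rightarrow> real^'n" "nat \<Rightarrow> 'a \<Rightarrow> real"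

definition residual ::
    "real \<Rightarrow> (nat \<Rightarrow> 'a \<Rightarrow> real^'n) \<Rightarrow> (nat \<Rightarrow> 'a \<Rightarrow> real^'n) \<Rightarrow> nat \<Rightarrow> 'a \<Rightarrow> real^'n" where
  "residual l \<zeta> \<nu> t \<omega> = (1 - l) *\<^sub>R \<zeta> t \<omega> + l *\<^sub>R \<nu> t \<omega>"

fun innovation :: "('a, 'n::finite) regime \<Rightarrow> nat \<Rightarrow> 'a \<Rightarrow> real^'n" where
  "innovation (Inert \<zeta>e) = \<zeta>e"
| "innovation (Forced \<zeta>e \<zeta>b) = (\<lambda>t \<omega>. \<zeta>e t \<omega> + \<zeta>b t \<omega>)"
| "innovation (Stabilized l \<zeta> \<nu> K) = (\<lambda>t \<omega>. (1 - K t \<omega>) *\<^sub>R residual l \<zeta> \<nu> t \<omega>)"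

fun twin_innovation :: "('a, 'n::finite) regime \<Rightarrow> nat \<Rightarrow> 'a \<Rightarrow> real^'n" where
  "twin_innovation (Inert \<zeta>e) = innovation (Inert \<zeta>e)"
| "twin_innovation (Forced \<zeta>e \<zeta>b) = innovation (Forced \<zeta>e \<zeta>b)"
| "twin_innovation (Stabilized l \<zeta> \<nu> K) = \<zeta>"

fun uncorrected :: "('a, 'n::finite) regime \<Rightarrow> bool" where
  "uncorrected (Inert \<zeta>e) = True"
| "uncorrected (Forced \<zeta>e \<zeta>b) = True"
| "uncorrected (Stabilized l \<zeta> \<nu> K) = False"

text \<open>A channel is conditionally centered with finite conditional covariance at every step.\<close>

definition channel ::
    "'a measure \<Rightarrow> (nat \<Rightarrow> 'a measure) \<Rightarrow> (nat \<Rightarrow> 'a \<Rightarrow> real^'n) \<Rightarrow> bool" where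
  "channel M F X \<longleftrightarrow>
     (\<forall>t\<ge>1. cond_centered M (F (t - 1)) (X t) \<and> cond_finite_cov M (F (t - 1)) (X t))"

definition channels_cond_indep ::
    "'a measure \<Rightarrow> (nat \<Rightarrow> 'a measure) \<Rightarrow>
     (nat \<Rightarrow> 'a \<Rightarrow> real^'n) \<Rightarrow> (nat \<Rightarrow> 'a \<Rightarrow> real^'n) \<Rightarrow> bool" where
  "channels_cond_indep M F X Y \<longleftrightarrow> (\<forall>t\<ge>1. cond_indep M (F (t - 1)) (X t) (Y t))"

definition recovery_gain ::
    "'a measure \<Rightarrow> (nat \<Rightarrow> 'a measure) \<Rightarrow> (nat \<Rightarrow> 'a \<Rightarrow> real) \<Rightarrow> bool" where
  "recovery_gain M F K \<longleftrightarrow>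
     (\<forall>t\<ge>1. K t \<in> borel_measurable (F (t - 1))) \<and>
     (\<exists>Kmax<1. \<forall>t\<ge>1. AE \<omega> in M. 0 \<le> K t \<omega> \<and> K t \<omega> \<le> Kmax)"

fun regime_model ::
    "'a measure \<Rightarrow> (nat \<Rightarrow> 'a measure) \<Rightarrow> ('a, 'n::finite) regime \<Rightarrow> bool" where
  "regime_model M F (Inert \<zeta>e) = channel M F \<zeta>e"
| "regime_model M F (Forced \<zeta>e \<zeta>b) = (channel M F \<zeta>e \<and> channel M F \<zeta>b)"
| "regime_model M F (Stabilized l \<zeta> \<nu> K) =
     (0 \<le> l \<and> l \<le> 1 \<and> channel M F \<zeta> \<and> channel M F \<nu> \<and>
      channels_cond_indep M F \<zeta> \<nu> \<and> recovery_gain M F K)"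


subsection \<open>Increments between the event and the quiet set\<close>

definition step_cov ::
    "'a measure \<Rightarrow> (nat \<Rightarrow> 'a measure) \<Rightarrow> (nat \<Rightarrow> 'a \<Rightarrow> real^'n) \<Rightarrow> nat \<Rightarrow> 'a \<Rightarrow> real^'n^'n" where
  "step_cov M F X t \<omega> = cond_cov M (F (t - 1)) (X t) \<omega>"

definition step_trace ::
    "'a measure \<Rightarrow> (nat \<Rightarrow> 'a measure) \<Rightarrow> (nat \<Rightarrow> 'a \<Rightarrow> real^'n) \<Rightarrow> nat \<Rightarrow> 'a \<Rightarrow> real" where
  "step_trace M F X t \<omega> = trace (step_cov M F X t \<omega>)"

definition step_kurt ::
    "'a measure \<Rightarrow> (nat \<Rightarrow> 'a measure) \<Rightarrow> real^'n \<Rightarrow> (nat \<Rightarrow> 'a \<Rightarrow> real^'n) \<Rightarrow> nat \<Rightarrow> 'a \<Rightarrow> real" where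
  "step_kurt M F u X t \<omega> = cond_kurt M (F (t - 1)) (scalar_proj u X t) \<omega>"

definition trace_increment ::
    "'a measure \<Rightarrow> (nat \<Rightarrow> 'a measure) \<Rightarrow> (nat \<times> 'a) set \<Rightarrow> (nat \<times> 'a) set \<Rightarrow>
     (nat \<Rightarrow> 'a \<Rightarrow> real^'n) \<Rightarrow> real" where
  "trace_increment M F event quiet X =
     window_avg M event (step_trace M F X) - window_avg M quiet (step_trace M F X)"

definition kurt_increment ::
    "'a measure \<Rightarrow> (nat \<times> 'a) set \<Rightarrow> (nat \<times> 'a) set \<Rightarrow> real^'n \<Rightarrow>
     (nat \<Rightarrow> 'a \<Rightarrow> real^'n) \<Rightarrow> real" where
  "kurt_increment M event quiet u X =
     kurt (window_law M event) (pooled_proj u X) - kurt (window_law M quiet) (pooled_proj u X)"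

definition avg_cond_kurt_increment ::
    "'a measure \<Rightarrow> (nat \<Rightarrow> 'a measure) \<Rightarrow> (nat \<times> 'a) set \<Rightarrow> (nat \<times> 'a) set \<Rightarrow> real^'n \<Rightarrow>
     (nat \<Rightarrow> 'a \<Rightarrow> real^'n) \<Rightarrow> real" where
  "avg_cond_kurt_increment M F event quiet u X =
     window_avg M event (step_kurt M F u X) - window_avg M quiet (step_kurt M F u X)"

definition dH ::
    "'a measure \<Rightarrow> (nat \<Rightarrow> 'a measure) \<Rightarrow> (nat \<times> 'a) set \<Rightarrow> (nat \<times> 'a) set \<Rightarrow>
     ('a, 'n::finite) regime \<Rightarrow> real" where
  "dH M F event quiet R = trace_increment M F event quiet (innovation R)"

text \<open>The increment of the unstabilized twin, which is both \<open>\<Delta>V\<close> and \<open>\<Delta>H\<close> of the twin.\<close>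

definition dV ::
    "'a measure \<Rightarrow> (nat \<Rightarrow> 'a measure) \<Rightarrow> (nat \<times> 'a) set \<Rightarrow> (nat \<times> 'a) set \<Rightarrow>
     ('a, 'n::finite) regime \<Rightarrow> real" where
  "dV M F event quiet R = trace_increment M F event quiet (twin_innovation R)"

definition finite_traces ::
    "'a measure \<Rightarrow> (nat \<Rightarrow> 'a measure) \<Rightarrow> (nat \<times> 'a) set \<Rightarrow> (nat \<times> 'a) set \<Rightarrow>
     (nat \<Rightarrow> 'a \<Rightarrow> real^'n) \<Rightarrow> bool" where
  "finite_traces M F event quiet X \<longleftrightarrow>
     window_integrable M event (step_trace M F X) \<and> window_integrable M quiet (step_trace M F X)"

text \<open>In the forced regime positivity of \<^const>\<open>dV\<close> is not assumed: it follows from the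
  conditional independence of the channels and the sign of the sum of their increments.\<close>

fun forcing_rises ::
    "'a measure \<Rightarrow> (nat \<Rightarrow> 'a measure) \<Rightarrow> (nat \<times> 'a) set \<Rightarrow> (nat \<times> 'a) set \<Rightarrow>
     ('a, 'n::finite) regime \<Rightarrow> bool" where
  "forcing_rises M F event quiet (Inert \<zeta>e) =
     (finite_traces M F event quiet \<zeta>e \<and> dV M F event quiet (Inert \<zeta>e) > 0)"
| "forcing_rises M F event quiet (Forced \<zeta>e \<zeta>b) =
     (channels_cond_indep M F \<zeta>e \<zeta>b \<and>
      finite_traces M F event quiet \<zeta>e \<and> finite_traces M F event quiet \<zeta>b \<and>
      trace_increment M F event quiet \<zeta>e + trace_increment M F event quiet \<zeta>b > 0)"
| "forcing_rises M F event quiet (Stabilized l \<zeta> \<nu> K) =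
     (finite_traces M F event quiet \<zeta> \<and> dV M F event quiet (Stabilized l \<zeta> \<nu> K) > 0)"

text \<open>The entrywise average over \<open>W\<close> of the conditional covariances of \<open>X\<close>.\<close>

definition window_cov ::
    "'a measure \<Rightarrow> (nat \<Rightarrow> 'a measure) \<Rightarrow> (nat \<times> 'a) set \<Rightarrow>
     (nat \<Rightarrow> 'a \<Rightarrow> real^'n) \<Rightarrow> real^'n^'n" where
  "window_cov M F W X = (\<chi> i j. window_avg M W (\<lambda>t \<omega>. step_cov M F X t \<omega> $ i $ j))"

definition pos_definite :: "real^'n^'n \<Rightarrow> bool" where
  "pos_definite A \<longleftrightarrow> transpose A = A \<and> (\<forall>x. x \<noteq> 0 \<longrightarrow> 0 < x \<bullet> (A *v x))"

end

theory Submission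
  imports Defs
begin

text \<open>Two facts about a sum of independent centered variables with variances \<open>a\<close>, \<open>b\<close> carry the whole
  result. Variances add, and since the cross terms with an odd power vanish, the fourth moment of the
  sum is \<open>m + 6 a b + n\<close>, where \<open>m\<close>, \<open>n\<close> are the fourth moments of the summands. The term
  \<open>6 a b\<close> is exactly the cross term of \<open>3 (a + b)\<^sup>2\<close>, so the excess fourth moments
  \<open>m - 3 a\<^sup>2\<close> and \<open>n - 3 b\<^sup>2\<close> (fourth cumulants) add too; dividing by
  \<open>(a + b)\<^sup>2\<close> turns this into the combination of the two kurtoses with squared variance shares
  (\<open>excess_kurtosis_add_algebra\<close>). Multiplication by a nonzero factor leaves kurtosis unchanged
  and multiplies variance by the square of the factor. The shape claims are these two
  facts together with \<open>v\<^sup>2 + w\<^sup>2 \<le> 1\<close> for shares \<open>v\<close>, \<open>w\<close>, or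
  \<open>w\<^sup>2 < 1\<close> for a single proper share.

  For laws of a window this is ordinary integration (\<open>kurt_indep_add\<close>). At a conditional history the
  difficulty is that the moments are finite only conditionally: a channel need not be integrable,
  so linearity and the product rule for conditional expectations have to be
  used at those histories where the conditional absolute moments happen to be finite. Everything is
  therefore derived from \<^const>\<open>nn_cond_exp\<close>, which obeys its rules without integrability, by
  splitting real functions into positive and negative parts
  (\<open>real_cond_exp_add_at\<close>, \<open>real_cond_exp_measurable_mult\<close>, \<open>real_cond_exp_indep_mult\<close>).
  Independence and equality of standardized laws are given on sets; \<open>nn_cond_exp_transfer\<close> carries
  both to moments. The outcome is \<open>cond_kurt_indep_add\<close>, the conditional counterpart of
  \<open>kurt_indep_add\<close>. Statements that hold almost surely at each step hold almost everywhere in a window,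
  because there are only countably many steps (\<open>AE_window_law\<close>).

  For the variance in the stabilized regime, applying additivity and scaling to each coordinate gives
  \<open>tr H\<^sub>t = (1 - K\<^sub>t)\<^sup>2 ((1 - \<lambda>)\<^sup>2 V\<^sub>t + \<lambda>\<^sup>2 tr F\<^sub>\<nu>)\<close>. In
  the difference between event and quiet averages the constant floor term cancels; a gain that acts only
  during the event can only lower the first average, and a common constant gain factors out.\<close>

section \<open>Conditional expectations of conditionally integrable functions\<close>

text \<open>A pointwise notion of integrability: it singles out the histories at which \<^const>\<open>real_cond_exp\<close>
  is a difference of two finite numbers and hence behaves like an expectation.\<close>

definition cond_integrable_at ::
    "'a measure \<Rightarrow> 'a measure \<Rightarrow> ('a \<Rightarrow> real) \<Rightarrow> 'a \<Rightarrow> bool" where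
  "cond_integrable_at M G f \<omega> \<longleftrightarrow> nn_cond_exp M G (\<lambda>x. ennreal \<bar>f x\<bar>) \<omega> < \<infinity>"

context sigma_finite_subalgebra
begin

lemma nn_cond_exp_const: "AE x in M. nn_cond_exp M F (\<lambda>_. c) x = c"
  using nn_cond_exp_F_meas[of "\<lambda>_. c"] by auto

lemma cond_integrable_at_const: "AE \<omega> in M. cond_integrable_at M F (\<lambda>_. c) \<omega>"
  using nn_cond_exp_const[of "ennreal \<bar>c\<bar>"] by (auto simp: cond_integrable_at_def)

lemma real_cond_exp_eq_enn2real:
  assumes "\<And>x. 0 \<le> f x"
  shows "AE \<omega> in M. real_cond_exp M F f \<omega> = enn2real (nn_cond_exp M F (\<lambda>x. ennreal (f x)) \<omega>)"
proof -
  have "(\<lambda>x. ennreal (- f x)) = (\<lambda>_. 0)"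
    using assms by (auto simp: ennreal_neg)
  with nn_cond_exp_const[of 0] show ?thesis
    by (auto simp: real_cond_exp_def)
qed

lemma real_cond_exp_const: "AE \<omega> in M. real_cond_exp M F (\<lambda>_. c) \<omega> = c"
  using nn_cond_exp_const[of "ennreal c"] nn_cond_exp_const[of "ennreal (- c)"]
  by eventually_elim (cases "0 \<le> c"; simp add: real_cond_exp_def ennreal_neg)

lemma cond_integrable_at_mono:
  assumes "\<And>x. \<bar>f x\<bar> \<le> \<bar>g x\<bar>" and [measurable]: "f \<in> borel_measurable M" "g \<in> borel_measurable M"
  shows "AE \<omega> in M. cond_integrable_at M F g \<omega> \<longrightarrow> cond_integrable_at M F f \<omega>"
  using nn_cond_exp_mono[of "\<lambda>x. ennreal \<bar>f x\<bar>" "\<lambda>x. ennreal \<bar>g x\<bar>"] assms(1)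
  by (auto simp: cond_integrable_at_def intro!: ennreal_leI elim!: eventually_mono)

lemma cond_integrable_at_add:
  assumes [measurable]: "f \<in> borel_measurable M" "g \<in> borel_measurable M"
  shows "AE \<omega> in M. cond_integrable_at M F f \<omega> \<and> cond_integrable_at M F g \<omega> \<longrightarrow>
    cond_integrable_at M F (\<lambda>x. f x + g x) \<omega>"
proof -
  have "AE \<omega> in M. nn_cond_exp M F (\<lambda>x. ennreal \<bar>f x + g x\<bar>) \<omega>
      \<le> nn_cond_exp M F (\<lambda>x. ennreal \<bar>f x\<bar> + ennreal \<bar>g x\<bar>) \<omega>"
    by (rule nn_cond_exp_mono) (auto simp: ennreal_plus[symmetric] simp del: ennreal_plus intro!: ennreal_leI)
  with nn_cond_exp_sum[of "\<lambda>x. ennreal \<bar>f x\<bar>" "\<lambda>x. ennreal \<bar>g x\<bar>", simplified]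
  show ?thesis
    unfolding cond_integrable_at_def
    by eventually_elim (auto simp: less_top[symmetric] top_unique)
qed

lemma cond_integrable_at_measurable_mult:
  assumes [measurable]: "h \<in> borel_measurable F" "f \<in> borel_measurable M"
  shows "AE \<omega> in M. cond_integrable_at M F f \<omega> \<longrightarrow> cond_integrable_at M F (\<lambda>x. h x * f x) \<omega>"
proof -
  have "AE \<omega> in M. ennreal \<bar>h \<omega>\<bar> * nn_cond_exp M F (\<lambda>x. ennreal \<bar>f x\<bar>) \<omega> =
      nn_cond_exp M F (\<lambda>x. ennreal \<bar>h x\<bar> * ennreal \<bar>f x\<bar>) \<omega>"
    by (rule nn_cond_exp_prod) auto
  then show ?thesis
  proof eventually_elim
    case (elim \<omega>)
    then show ?case
      by (simp add: cond_integrable_at_def abs_mult ennreal_mult ennreal_mult_less_top elim[symmetric])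
  qed
qed

text \<open>A power is dominated by 1 plus any higher power, so lower conditional moments are finite wherever a
  higher one is.\<close>

lemma cond_integrable_at_power_le:
  assumes [measurable]: "f \<in> borel_measurable M" and "k \<le> n"
  shows "AE \<omega> in M. cond_integrable_at M F (\<lambda>x. f x ^ n) \<omega> \<longrightarrow> cond_integrable_at M F (\<lambda>x. f x ^ k) \<omega>"
proof -
  have le: "\<bar>f x ^ k\<bar> \<le> \<bar>1 + \<bar>f x ^ n\<bar>\<bar>" for x
  proof (cases "\<bar>f x\<bar> \<le> 1")
    case True
    then show ?thesis by (simp add: power_abs power_le_one add_increasing2)
  next
    case False
    then have "\<bar>f x\<bar> ^ k \<le> \<bar>f x\<bar> ^ n" using \<open>k \<le> n\<close> by (intro power_increasing) auto
    then show ?thesis by (simp add: power_abs)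
  qed
  have "AE \<omega> in M. cond_integrable_at M F (\<lambda>x. 1 + \<bar>f x ^ n\<bar>) \<omega> \<longrightarrow> cond_integrable_at M F (\<lambda>x. f x ^ k) \<omega>"
    by (rule cond_integrable_at_mono[OF le]) auto
  moreover have "AE \<omega> in M. cond_integrable_at M F (\<lambda>_. 1) \<omega> \<and> cond_integrable_at M F (\<lambda>x. \<bar>f x ^ n\<bar>) \<omega> \<longrightarrow>
      cond_integrable_at M F (\<lambda>x. 1 + \<bar>f x ^ n\<bar>) \<omega>"
    by (rule cond_integrable_at_add) auto
  ultimately show ?thesis
    using cond_integrable_at_const[of 1]
    by eventually_elim (auto simp: cond_integrable_at_def)
qed

lemma nn_cond_exp_sum3:
  assumes [measurable]: "f \<in> borel_measurable M" "g \<in> borel_measurable M" "h \<in> borel_measurable M"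
  shows "AE x in M. nn_cond_exp M F f x + (nn_cond_exp M F g x + nn_cond_exp M F h x) =
    nn_cond_exp M F (\<lambda>x. f x + (g x + h x)) x"
proof -
  have "AE x in M. nn_cond_exp M F f x + nn_cond_exp M F (\<lambda>x. g x + h x) x =
      nn_cond_exp M F (\<lambda>x. f x + (g x + h x)) x"
    by (rule nn_cond_exp_sum) auto
  with nn_cond_exp_sum[OF assms(2,3)] show ?thesis by eventually_elim simp
qed

text \<open>Comparing positive and negative parts of \<open>f\<close>, \<open>g\<close> and \<open>f + g\<close> gives an identity between sums of
  nonnegative functions, to which \<^const>\<open>nn_cond_exp\<close> applies without integrability; at a history where
  all six conditional expectations are finite it can be rearranged.\<close>

lemma real_cond_exp_add_at:
  assumes [measurable]: "f \<in> borel_measurable M" "g \<in> borel_measurable M"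
  shows "AE \<omega> in M. cond_integrable_at M F f \<omega> \<and> cond_integrable_at M F g \<omega> \<longrightarrow>
    real_cond_exp M F (\<lambda>x. f x + g x) \<omega> = real_cond_exp M F f \<omega> + real_cond_exp M F g \<omega>"
proof -
  let ?N = "nn_cond_exp M F"
  let ?p = "\<lambda>h x. ennreal (h x)" and ?m = "\<lambda>h x. ennreal (- h x)"
  let ?s = "\<lambda>x. f x + g x"
  have split: "?p ?s x + (?m f x + ?m g x) = ?m ?s x + (?p f x + ?p g x)" for x
  proof -
    have "ennreal (max 0 (f x + g x) + (max 0 (- f x) + max 0 (- g x))) =
        ennreal (max 0 (- f x - g x) + (max 0 (f x) + max 0 (g x)))"
      by (rule arg_cong[where f=ennreal]) (auto simp: max_def)
    moreover have "ennreal (max 0 a + (max 0 b + max 0 c)) = ennreal a + (ennreal b + ennreal c)" for a b c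
      by (simp add: ennreal_max_0)
    ultimately show ?thesis by simp
  qed
  have bound: "AE \<omega> in M. ?N (?p h) \<omega> \<le> ?N (\<lambda>x. ennreal \<bar>h x\<bar>) \<omega>"
      "AE \<omega> in M. ?N (?m h) \<omega> \<le> ?N (\<lambda>x. ennreal \<bar>h x\<bar>) \<omega>" if [measurable]: "h \<in> borel_measurable M" for h
    by (rule nn_cond_exp_mono; auto intro!: ennreal_leI)+
  have "AE \<omega> in M. ?N (?p ?s) \<omega> + (?N (?m f) \<omega> + ?N (?m g) \<omega>) = ?N (\<lambda>x. ?p ?s x + (?m f x + ?m g x)) \<omega>"
    by (rule nn_cond_exp_sum3) auto
  moreover have "AE \<omega> in M. ?N (?m ?s) \<omega> + (?N (?p f) \<omega> + ?N (?p g) \<omega>) = ?N (\<lambda>x. ?m ?s x + (?p f x + ?p g x)) \<omega>"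
    by (rule nn_cond_exp_sum3) auto
  moreover note cond_integrable_at_add[OF assms]
    bound[OF assms(1)] bound[OF assms(2)]
    bound[OF borel_measurable_add[OF assms]]
  ultimately have "AE \<omega> in M. ?N (?p ?s) \<omega> + (?N (?m f) \<omega> + ?N (?m g) \<omega>) =
      ?N (?m ?s) \<omega> + (?N (?p f) \<omega> + ?N (?p g) \<omega>) \<and>
      (cond_integrable_at M F f \<omega> \<and> cond_integrable_at M F g \<omega> \<longrightarrow>
       ?N (?p f) \<omega> < \<infinity> \<and> ?N (?m f) \<omega> < \<infinity> \<and> ?N (?p g) \<omega> < \<infinity> \<and> ?N (?m g) \<omega> < \<infinity> \<and>
       ?N (?p ?s) \<omega> < \<infinity> \<and> ?N (?m ?s) \<omega> < \<infinity>)"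
    unfolding cond_integrable_at_def split
    by eventually_elim (auto simp: less_top[symmetric] top_unique)
  then show ?thesis
  proof eventually_elim
    case (elim \<omega>)
    have real: "enn2real a - enn2real b = (enn2real c - enn2real d) + (enn2real e - enn2real r)"
      if "a + (d + r) = b + (c + e)" and "c < \<infinity>" "d < \<infinity>" "e < \<infinity>" "r < \<infinity>" "a < \<infinity>" "b < \<infinity>"
      for a b c d e r
    proof -
      have "enn2real (a + (d + r)) = enn2real (b + (c + e))" using that(1) by simp
      then show ?thesis using that(2-) by (simp add: enn2real_plus)
    qed
    show ?case
      using elim real unfolding real_cond_exp_def by blast
  qed
qed

text \<open>At a given history the known factor \<open>h\<close> multiplies the two parts of \<open>f\<close> by the same finite number
  (after exchanging them if \<open>h\<close> is negative there), and reading infinity as 0 commutes with that. Hence the rule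
  holds even where the conditional expectation of \<open>f\<close> is not finite.\<close>

lemma real_cond_exp_measurable_mult:
  assumes [measurable]: "h \<in> borel_measurable F" "f \<in> borel_measurable M"
  shows "AE \<omega> in M. real_cond_exp M F (\<lambda>x. h x * f x) \<omega> = h \<omega> * real_cond_exp M F f \<omega>"
proof -
  let ?N = "nn_cond_exp M F"
  have [measurable]: "h \<in> borel_measurable M" by (rule measurable_from_subalg[OF subalg]) fact
  have split: "ennreal (h x * k x) = ennreal (h x) * ennreal (k x) + ennreal (- h x) * ennreal (- k x)"
    for k :: "'a \<Rightarrow> real" and x
    by (cases "0 \<le> h x"; cases "0 \<le> k x")
      (auto simp: ennreal_neg mult_nonneg_nonpos mult_nonpos_nonneg ennreal_mult[symmetric])
  have N: "AE \<omega> in M. ?N (\<lambda>x. ennreal (h x * k x)) \<omega> =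
        ennreal (h \<omega>) * ?N (\<lambda>x. ennreal (k x)) \<omega> + ennreal (- h \<omega>) * ?N (\<lambda>x. ennreal (- k x)) \<omega>"
      if [measurable]: "k \<in> borel_measurable M" for k
  proof -
    have "AE \<omega> in M. ennreal (h \<omega>) * ?N (\<lambda>x. ennreal (k x)) \<omega> = ?N (\<lambda>x. ennreal (h x) * ennreal (k x)) \<omega>"
      "AE \<omega> in M. ennreal (- h \<omega>) * ?N (\<lambda>x. ennreal (- k x)) \<omega> = ?N (\<lambda>x. ennreal (- h x) * ennreal (- k x)) \<omega>"
      "AE \<omega> in M. ?N (\<lambda>x. ennreal (h x) * ennreal (k x)) \<omega> + ?N (\<lambda>x. ennreal (- h x) * ennreal (- k x)) \<omega> =
        ?N (\<lambda>x. ennreal (h x * k x)) \<omega>"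
      unfolding split by (intro nn_cond_exp_prod nn_cond_exp_sum; measurable)+
    then show ?thesis by eventually_elim simp
  qed
  have N': "AE \<omega> in M. ?N (\<lambda>x. ennreal (- (h x * f x))) \<omega> =
        ennreal (h \<omega>) * ?N (\<lambda>x. ennreal (- f x)) \<omega> + ennreal (- h \<omega>) * ?N (\<lambda>x. ennreal (f x)) \<omega>"
    using N[of "\<lambda>x. - f x"] by simp
  from N[OF assms(2)] N' show ?thesis
  proof eventually_elim
    case (elim \<omega>)
    then show ?case
      by (cases "0 \<le> h \<omega>") (simp_all add: real_cond_exp_def ennreal_neg enn2real_mult algebra_simps)
  qed
qed

lemma nn_cond_exp_SUP:
  assumes [measurable]: "\<And>i. f i \<in> borel_measurable M" and "incseq f"
  shows "AE \<omega> in M. (SUP i. nn_cond_exp M F (f i) \<omega>) = nn_cond_exp M F (\<lambda>x. SUP i. f i x) \<omega>"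
proof (rule nn_cond_exp_charact)
  fix A assume A: "A \<in> sets F"
  then have [measurable]: "A \<in> sets M" using subalg by (auto simp: subalgebra_def)
  have ind: "indicator A \<in> borel_measurable F" using A by measurable
  have mono: "AE \<omega> in M. nn_cond_exp M F (f i) \<omega> \<le> nn_cond_exp M F (f (Suc i)) \<omega>" for i
    by (rule nn_cond_exp_mono) (use \<open>incseq f\<close> in \<open>auto simp: incseq_Suc_iff le_fun_def\<close>)
  have "(\<integral>\<^sup>+x\<in>A. (SUP i. f i x) \<partial>M) = (\<integral>\<^sup>+x. (SUP i. indicator A x * f i x) \<partial>M)"
    by (intro nn_integral_cong) (simp add: SUP_mult_left_ennreal mult.commute)
  also have "\<dots> = (SUP i. \<integral>\<^sup>+x. indicator A x * f i x \<partial>M)"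
    by (rule nn_integral_monotone_convergence_SUP)
      (use \<open>incseq f\<close> in \<open>auto simp: incseq_def le_fun_def intro!: mult_left_mono\<close>)
  also have "\<dots> = (SUP i. \<integral>\<^sup>+x. indicator A x * nn_cond_exp M F (f i) x \<partial>M)"
    by (simp add: nn_cond_exp_intg[OF ind])
  also have "\<dots> = (\<integral>\<^sup>+x. (SUP i. indicator A x * nn_cond_exp M F (f i) x) \<partial>M)"
    by (rule nn_integral_monotone_convergence_SUP_AE[symmetric])
      (use mono in \<open>auto intro!: mult_left_mono eventually_mono[OF mono]\<close>)
  also have "\<dots> = (\<integral>\<^sup>+x\<in>A. (SUP i. nn_cond_exp M F (f i) x) \<partial>M)"
    by (intro nn_integral_cong) (simp add: SUP_mult_left_ennreal mult.commute)
  finally show "(\<integral>\<^sup>+x\<in>A. (SUP i. f i x) \<partial>M) = (\<integral>\<^sup>+x\<in>A. (SUP i. nn_cond_exp M F (f i) x) \<partial>M)" .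
qed auto

text \<open>The passage from events to functions by monotone approximation, in a form that serves two purposes.
  With \<open>Y = X\<close>, \<open>k = a = 1\<close> and \<open>b\<close> the conditional expectation of \<open>h\<close> it extends a product rule for
  probabilities; with \<open>h = k = 1\<close> and \<open>a = b\<close> an indicator it extends equality of conditional laws
  on a set of histories.\<close>

lemma nn_cond_exp_transfer:
  fixes X Y :: "'a \<Rightarrow> 'b::topological_space" and f :: "'b \<Rightarrow> ennreal"
  assumes [measurable]: "X \<in> borel_measurable M" "Y \<in> borel_measurable M"
      "h \<in> borel_measurable M" "k \<in> borel_measurable M"
    and ind: "\<And>B. B \<in> sets borel \<Longrightarrow> AE \<omega> in M.
      nn_cond_exp M F (\<lambda>x. indicator B (X x) * h x) \<omega> * a \<omega> =
      nn_cond_exp M F (\<lambda>x. indicator B (Y x) * k x) \<omega> * b \<omega>"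
    and "f \<in> borel_measurable borel"
  shows "AE \<omega> in M. nn_cond_exp M F (\<lambda>x. f (X x) * h x) \<omega> * a \<omega> =
      nn_cond_exp M F (\<lambda>x. f (Y x) * k x) \<omega> * b \<omega>"
  using \<open>f \<in> borel_measurable borel\<close>
proof (induct rule: borel_measurable_induct)
  case (cong f g)
  then have "f = g" by auto
  with cong show ?case by simp
next
  case (set B)
  then show ?case by (rule ind)
next
  case (mult u c)
  note [measurable] = mult(2)
  have "AE \<omega> in M. c * nn_cond_exp M F (\<lambda>x. u (X x) * h x) \<omega> = nn_cond_exp M F (\<lambda>x. c * (u (X x) * h x)) \<omega>"
    "AE \<omega> in M. c * nn_cond_exp M F (\<lambda>x. u (Y x) * k x) \<omega> = nn_cond_exp M F (\<lambda>x. c * (u (Y x) * k x)) \<omega>"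
    by (rule nn_cond_exp_prod; measurable)+
  with mult(4) show ?case
    unfolding mult.assoc by eventually_elim (metis mult.assoc)
next
  case (add u v)
  note [measurable] = add(1,4)
  have "AE \<omega> in M. nn_cond_exp M F (\<lambda>x. v (X x) * h x) \<omega> + nn_cond_exp M F (\<lambda>x. u (X x) * h x) \<omega> =
      nn_cond_exp M F (\<lambda>x. v (X x) * h x + u (X x) * h x) \<omega>"
    "AE \<omega> in M. nn_cond_exp M F (\<lambda>x. v (Y x) * k x) \<omega> + nn_cond_exp M F (\<lambda>x. u (Y x) * k x) \<omega> =
      nn_cond_exp M F (\<lambda>x. v (Y x) * k x + u (Y x) * k x) \<omega>"
    by (rule nn_cond_exp_sum; measurable)+
  with add(3,7) show ?case
    unfolding distrib_right
  proof eventually_elim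
    case (elim \<omega>)
    then show ?case by (simp add: elim(3,4)[symmetric] distrib_right)
  qed
next
  case (seq U)
  note [measurable] = seq(1)
  have inc: "incseq (\<lambda>i x. U i (X x) * h x)" "incseq (\<lambda>i x. U i (Y x) * k x)"
    using \<open>incseq U\<close> by (auto simp: incseq_def le_fun_def intro!: mult_right_mono)
  have "AE \<omega> in M. \<forall>i. nn_cond_exp M F (\<lambda>x. U i (X x) * h x) \<omega> * a \<omega> =
      nn_cond_exp M F (\<lambda>x. U i (Y x) * k x) \<omega> * b \<omega>"
    using seq(3) by (simp add: AE_all_countable)
  moreover have "AE \<omega> in M. (SUP i. nn_cond_exp M F (\<lambda>x. U i (X x) * h x) \<omega>) =
      nn_cond_exp M F (\<lambda>x. SUP i. U i (X x) * h x) \<omega>"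
    "AE \<omega> in M. (SUP i. nn_cond_exp M F (\<lambda>x. U i (Y x) * k x) \<omega>) =
      nn_cond_exp M F (\<lambda>x. SUP i. U i (Y x) * k x) \<omega>"
    by (rule nn_cond_exp_SUP[OF _ inc(1)] nn_cond_exp_SUP[OF _ inc(2)]; measurable)+
  ultimately show ?case
  proof eventually_elim
    case (elim \<omega>)
    have "(SUP i. nn_cond_exp M F (\<lambda>x. U i (X x) * h x) \<omega>) * a \<omega> =
        (SUP i. nn_cond_exp M F (\<lambda>x. U i (Y x) * k x) \<omega>) * b \<omega>"
      using elim(1) by (simp add: SUP_mult_right_ennreal)
    then show ?case
      using elim(2,3) by (simp add: image_comp SUP_mult_right_ennreal)
  qed
qed

end

section \<open>Conditional moments of sums of conditionally independent variables\<close>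

context sigma_finite_subalgebra
begin

lemma nn_cond_exp_eq_cond_prob:
  assumes [measurable]: "S \<in> sets M" "g \<in> borel_measurable M"
    and g: "\<And>x. x \<in> space M \<Longrightarrow> g x = indicator S x"
  shows "AE \<omega> in M. nn_cond_exp M F g \<omega> = ennreal (cond_prob_given M F S \<omega>) \<and> 0 \<le> cond_prob_given M F S \<omega>"
proof -
  have "AE \<omega> in M. nn_cond_exp M F g \<omega> = nn_cond_exp M F (indicator S) \<omega>"
    by (rule nn_cond_exp_cong) (auto simp: g)
  moreover have "AE \<omega> in M. nn_cond_exp M F (indicator S) \<omega> \<le> nn_cond_exp M F (\<lambda>_. 1) \<omega>"
    by (rule nn_cond_exp_mono) (auto simp: indicator_def)
  moreover have "AE \<omega> in M. cond_prob_given M F S \<omega> = enn2real (nn_cond_exp M F (indicator S) \<omega>)"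
    using real_cond_exp_eq_enn2real[of "indicator S"] by (simp add: cond_prob_given_def ennreal_indicator)
  ultimately show ?thesis
    using nn_cond_exp_const[of 1]
  proof eventually_elim
    case (elim \<omega>)
    then have "nn_cond_exp M F (indicator S) \<omega> < top" using le_less_trans by fastforce
    with elim show ?case by simp
  qed
qed

text \<open>Independence is extended from events to functions in one argument after the other.\<close>

lemma nn_cond_exp_indep_mult:
  fixes X Y :: "'a \<Rightarrow> real^'n" and f g :: "real^'n \<Rightarrow> ennreal"
  assumes [measurable]: "X \<in> borel_measurable M" "Y \<in> borel_measurable M"
    and indep: "cond_indep M F X Y"
    and [measurable]: "f \<in> borel_measurable borel" "g \<in> borel_measurable borel"
  shows "AE \<omega> in M. nn_cond_exp M F (\<lambda>x. f (X x) * g (Y x)) \<omega> =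
    nn_cond_exp M F (\<lambda>x. f (X x)) \<omega> * nn_cond_exp M F (\<lambda>x. g (Y x)) \<omega>"
proof -
  have sets: "AE \<omega> in M. nn_cond_exp M F (\<lambda>x. indicator A (X x) * indicator B (Y x)) \<omega> =
      nn_cond_exp M F (\<lambda>x. indicator A (X x)) \<omega> * nn_cond_exp M F (\<lambda>x. indicator B (Y x)) \<omega>"
    if [measurable]: "A \<in> sets borel" "B \<in> sets borel" for A B
  proof -
    have "AE \<omega> in M. cond_prob_given M F {x \<in> space M. X x \<in> A \<and> Y x \<in> B} \<omega> =
        cond_prob_given M F {x \<in> space M. X x \<in> A} \<omega> *
        cond_prob_given M F {x \<in> space M. Y x \<in> B} \<omega>"
      using indep that unfolding cond_indep_def by blast
    moreover have "AE \<omega> in M. nn_cond_exp M F (\<lambda>x. indicator A (X x) * indicator B (Y x)) \<omega> =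
        ennreal (cond_prob_given M F {x \<in> space M. X x \<in> A \<and> Y x \<in> B} \<omega>) \<and>
        0 \<le> cond_prob_given M F {x \<in> space M. X x \<in> A \<and> Y x \<in> B} \<omega>"
      by (rule nn_cond_exp_eq_cond_prob) (auto simp: indicator_def)
    moreover have "AE \<omega> in M. nn_cond_exp M F (\<lambda>x. indicator A (X x)) \<omega> =
        ennreal (cond_prob_given M F {x \<in> space M. X x \<in> A} \<omega>) \<and>
        0 \<le> cond_prob_given M F {x \<in> space M. X x \<in> A} \<omega>"
      by (rule nn_cond_exp_eq_cond_prob) (auto simp: indicator_def)
    moreover have "AE \<omega> in M. nn_cond_exp M F (\<lambda>x. indicator B (Y x)) \<omega> =
        ennreal (cond_prob_given M F {x \<in> space M. Y x \<in> B} \<omega>) \<and>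
        0 \<le> cond_prob_given M F {x \<in> space M. Y x \<in> B} \<omega>"
      by (rule nn_cond_exp_eq_cond_prob) (auto simp: indicator_def)
    ultimately show ?thesis
      by eventually_elim (simp add: ennreal_mult)
  qed
  have left: "AE \<omega> in M. nn_cond_exp M F (\<lambda>x. f (X x) * indicator B (Y x)) \<omega> * 1 =
      nn_cond_exp M F (\<lambda>x. f (X x) * 1) \<omega> * nn_cond_exp M F (\<lambda>x. indicator B (Y x)) \<omega>"
    if [measurable]: "B \<in> sets borel" for B
    by (rule nn_cond_exp_transfer[where b="nn_cond_exp M F (\<lambda>x. indicator B (Y x))"])
       (use sets[OF _ that] in auto)
  have "AE \<omega> in M. nn_cond_exp M F (\<lambda>x. g (Y x) * f (X x)) \<omega> * 1 =
      nn_cond_exp M F (\<lambda>x. g (Y x) * 1) \<omega> * nn_cond_exp M F (\<lambda>x. f (X x)) \<omega>"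
    by (rule nn_cond_exp_transfer[where b="nn_cond_exp M F (\<lambda>x. f (X x))"])
       (use left in \<open>auto simp: mult.commute\<close>)
  then show ?thesis by (simp add: mult.commute)
qed

text \<open>The positive part of a product is the sum of the products of like parts, the negative part that of unlike
  parts; each of these four products factors by independence.\<close>

lemma real_cond_exp_indep_mult:
  fixes X Y :: "'a \<Rightarrow> real^'n" and f g :: "real^'n \<Rightarrow> real"
  assumes [measurable]: "X \<in> borel_measurable M" "Y \<in> borel_measurable M"
    and indep: "cond_indep M F X Y"
    and [measurable]: "f \<in> borel_measurable borel" "g \<in> borel_measurable borel"
  shows "AE \<omega> in M. cond_integrable_at M F (\<lambda>x. f (X x)) \<omega> \<and> cond_integrable_at M F (\<lambda>x. g (Y x)) \<omega> \<longrightarrow>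
    cond_integrable_at M F (\<lambda>x. f (X x) * g (Y x)) \<omega> \<and>
    real_cond_exp M F (\<lambda>x. f (X x) * g (Y x)) \<omega> =
      real_cond_exp M F (\<lambda>x. f (X x)) \<omega> * real_cond_exp M F (\<lambda>x. g (Y x)) \<omega>"
proof -
  let ?N = "nn_cond_exp M F"
  let ?fp = "\<lambda>x. ennreal (f (X x))" and ?fm = "\<lambda>x. ennreal (- f (X x))"
  let ?gp = "\<lambda>x. ennreal (g (Y x))" and ?gm = "\<lambda>x. ennreal (- g (Y x))"
  have split: "ennreal (a * b) = ennreal a * ennreal b + ennreal (- a) * ennreal (- b)" for a b
    by (cases "0 \<le> a"; cases "0 \<le> b")
      (auto simp: ennreal_neg mult_nonneg_nonpos mult_nonpos_nonneg ennreal_mult[symmetric])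
  have split': "ennreal (- (a * b)) = ennreal a * ennreal (- b) + ennreal (- a) * ennreal b" for a b
    using split[of a "- b"] by simp
  have pos: "AE \<omega> in M. ?N (\<lambda>x. ennreal (f (X x) * g (Y x))) \<omega> = ?N ?fp \<omega> * ?N ?gp \<omega> + ?N ?fm \<omega> * ?N ?gm \<omega>"
  proof -
    have "AE \<omega> in M. ?N (\<lambda>x. ?fp x * ?gp x) \<omega> = ?N ?fp \<omega> * ?N ?gp \<omega>"
      "AE \<omega> in M. ?N (\<lambda>x. ?fm x * ?gm x) \<omega> = ?N ?fm \<omega> * ?N ?gm \<omega>"
      by (rule nn_cond_exp_indep_mult[OF assms(1,2) indep]; measurable)+
    moreover have "AE \<omega> in M. ?N (\<lambda>x. ?fp x * ?gp x) \<omega> + ?N (\<lambda>x. ?fm x * ?gm x) \<omega> =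
        ?N (\<lambda>x. ennreal (f (X x) * g (Y x))) \<omega>"
      unfolding split by (rule nn_cond_exp_sum) measurable
    ultimately show ?thesis by eventually_elim simp
  qed
  have neg: "AE \<omega> in M. ?N (\<lambda>x. ennreal (- (f (X x) * g (Y x)))) \<omega> = ?N ?fp \<omega> * ?N ?gm \<omega> + ?N ?fm \<omega> * ?N ?gp \<omega>"
  proof -
    have "AE \<omega> in M. ?N (\<lambda>x. ?fp x * ?gm x) \<omega> = ?N ?fp \<omega> * ?N ?gm \<omega>"
      "AE \<omega> in M. ?N (\<lambda>x. ?fm x * ?gp x) \<omega> = ?N ?fm \<omega> * ?N ?gp \<omega>"
      by (rule nn_cond_exp_indep_mult[OF assms(1,2) indep]; measurable)+
    moreover have "AE \<omega> in M. ?N (\<lambda>x. ?fp x * ?gm x) \<omega> + ?N (\<lambda>x. ?fm x * ?gp x) \<omega> =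
        ?N (\<lambda>x. ennreal (- (f (X x) * g (Y x)))) \<omega>"
      unfolding split' by (rule nn_cond_exp_sum) measurable
    ultimately show ?thesis by eventually_elim simp
  qed
  have abs: "AE \<omega> in M. ?N (\<lambda>x. ennreal \<bar>f (X x)\<bar> * ennreal \<bar>g (Y x)\<bar>) \<omega> =
      ?N (\<lambda>x. ennreal \<bar>f (X x)\<bar>) \<omega> * ?N (\<lambda>x. ennreal \<bar>g (Y x)\<bar>) \<omega>"
    by (rule nn_cond_exp_indep_mult[OF assms(1,2) indep]) measurable
  have bound: "AE \<omega> in M. ?N (\<lambda>x. ennreal (h x)) \<omega> \<le> ?N (\<lambda>x. ennreal \<bar>h x\<bar>) \<omega>"
      "AE \<omega> in M. ?N (\<lambda>x. ennreal (- h x)) \<omega> \<le> ?N (\<lambda>x. ennreal \<bar>h x\<bar>) \<omega>"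
    if [measurable]: "h \<in> borel_measurable M" for h
    by (rule nn_cond_exp_mono; auto intro!: ennreal_leI)+
  have [measurable]: "(\<lambda>x. f (X x)) \<in> borel_measurable M" "(\<lambda>x. g (Y x)) \<in> borel_measurable M"
    by measurable
  note b = bound[of "\<lambda>x. f (X x)", simplified] bound[of "\<lambda>x. g (Y x)", simplified]
  from pos neg abs b
  show ?thesis
  proof eventually_elim
    case (elim \<omega>)
    show ?case
    proof (intro impI)
      assume fin: "cond_integrable_at M F (\<lambda>x. f (X x)) \<omega> \<and> cond_integrable_at M F (\<lambda>x. g (Y x)) \<omega>"
      then have "cond_integrable_at M F (\<lambda>x. f (X x) * g (Y x)) \<omega>"
        using elim(3) by (simp add: cond_integrable_at_def abs_mult ennreal_mult ennreal_mult_less_top)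
      moreover from fin have "?N ?fp \<omega> < top" "?N ?fm \<omega> < top" "?N ?gp \<omega> < top" "?N ?gm \<omega> < top"
        using elim(4-) le_less_trans unfolding cond_integrable_at_def infinity_ennreal_def by blast+
      ultimately show "cond_integrable_at M F (\<lambda>x. f (X x) * g (Y x)) \<omega> \<and>
          real_cond_exp M F (\<lambda>x. f (X x) * g (Y x)) \<omega> =
          real_cond_exp M F (\<lambda>x. f (X x)) \<omega> * real_cond_exp M F (\<lambda>x. g (Y x)) \<omega>"
        unfolding real_cond_exp_def elim(1,2)
        by (simp add: enn2real_plus enn2real_mult ennreal_mult_less_top algebra_simps)
    qed
  qed
qed

lemma real_cond_exp_sum_at:
  assumes "finite I" "\<And>i. i \<in> I \<Longrightarrow> f i \<in> borel_measurable M"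
  shows "AE \<omega> in M. (\<forall>i\<in>I. cond_integrable_at M F (f i) \<omega>) \<longrightarrow>
    cond_integrable_at M F (\<lambda>x. \<Sum>i\<in>I. f i x) \<omega> \<and>
    real_cond_exp M F (\<lambda>x. \<Sum>i\<in>I. f i x) \<omega> = (\<Sum>i\<in>I. real_cond_exp M F (f i) \<omega>)"
  using assms
proof (induction I)
  case empty
  then show ?case
    using cond_integrable_at_const[of 0] real_cond_exp_const[of 0] by eventually_elim simp
next
  case (insert i I)
  have m: "f i \<in> borel_measurable M" "(\<lambda>x. \<Sum>i\<in>I. f i x) \<in> borel_measurable M"
    using insert.prems by (auto intro!: borel_measurable_sum)
  from insert.IH insert.prems have "AE \<omega> in M. (\<forall>i\<in>I. cond_integrable_at M F (f i) \<omega>) \<longrightarrow>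
    cond_integrable_at M F (\<lambda>x. \<Sum>i\<in>I. f i x) \<omega> \<and>
    real_cond_exp M F (\<lambda>x. \<Sum>i\<in>I. f i x) \<omega> = (\<Sum>i\<in>I. real_cond_exp M F (f i) \<omega>)"
    by auto
  with real_cond_exp_add_at[OF m] cond_integrable_at_add[OF m] show ?case
    by eventually_elim (simp add: insert.hyps)
qed

text \<open>The binomial theorem under the conditional expectation; each mixed moment factors by independence.
  Finiteness of the \<open>n\<close>-th moments at a history bounds all the moments that occur.\<close>

lemma cond_moment_indep_add:
  fixes X Y :: "'a \<Rightarrow> real^'n" and f g :: "real^'n \<Rightarrow> real"
  assumes [measurable]: "X \<in> borel_measurable M" "Y \<in> borel_measurable M"
    and indep: "cond_indep M F X Y"
    and [measurable]: "f \<in> borel_measurable borel" "g \<in> borel_measurable borel"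
  shows "AE \<omega> in M. cond_integrable_at M F (\<lambda>x. f (X x) ^ n) \<omega> \<and> cond_integrable_at M F (\<lambda>x. g (Y x) ^ n) \<omega> \<longrightarrow>
    real_cond_exp M F (\<lambda>x. (f (X x) + g (Y x)) ^ n) \<omega> =
    (\<Sum>k\<le>n. of_nat (n choose k) * real_cond_exp M F (\<lambda>x. f (X x) ^ k) \<omega> * real_cond_exp M F (\<lambda>x. g (Y x) ^ (n - k)) \<omega>)"
proof -
  let ?term = "\<lambda>k x. of_nat (n choose k) * (f (X x) ^ k * g (Y x) ^ (n - k))"
  have "AE \<omega> in M. \<forall>k\<in>{..n}. (cond_integrable_at M F (\<lambda>x. f (X x) ^ n) \<omega> \<longrightarrow> cond_integrable_at M F (\<lambda>x. f (X x) ^ k) \<omega>) \<and>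
     (cond_integrable_at M F (\<lambda>x. g (Y x) ^ n) \<omega> \<longrightarrow> cond_integrable_at M F (\<lambda>x. g (Y x) ^ (n - k)) \<omega>)"
    by (intro AE_finite_allI) (auto intro!: cond_integrable_at_power_le)
  moreover have "AE \<omega> in M. \<forall>k\<in>{..n}. cond_integrable_at M F (\<lambda>x. f (X x) ^ k) \<omega> \<and>
      cond_integrable_at M F (\<lambda>x. g (Y x) ^ (n - k)) \<omega> \<longrightarrow>
      cond_integrable_at M F (\<lambda>x. f (X x) ^ k * g (Y x) ^ (n - k)) \<omega> \<and>
      real_cond_exp M F (\<lambda>x. f (X x) ^ k * g (Y x) ^ (n - k)) \<omega> =
      real_cond_exp M F (\<lambda>x. f (X x) ^ k) \<omega> * real_cond_exp M F (\<lambda>x. g (Y x) ^ (n - k)) \<omega>"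
    by (intro AE_finite_allI real_cond_exp_indep_mult[OF assms(1,2) indep]) auto
  moreover have "AE \<omega> in M. \<forall>k\<in>{..n}. (cond_integrable_at M F (\<lambda>x. f (X x) ^ k * g (Y x) ^ (n - k)) \<omega> \<longrightarrow>
        cond_integrable_at M F (?term k) \<omega>) \<and>
      real_cond_exp M F (?term k) \<omega> =
        of_nat (n choose k) * real_cond_exp M F (\<lambda>x. f (X x) ^ k * g (Y x) ^ (n - k)) \<omega>"
    by (intro AE_finite_allI AE_conjI cond_integrable_at_measurable_mult real_cond_exp_measurable_mult) auto
  moreover have "AE \<omega> in M. (\<forall>k\<in>{..n}. cond_integrable_at M F (?term k) \<omega>) \<longrightarrow>
    cond_integrable_at M F (\<lambda>x. \<Sum>k\<le>n. ?term k x) \<omega> \<and>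
    real_cond_exp M F (\<lambda>x. \<Sum>k\<le>n. ?term k x) \<omega> = (\<Sum>k\<le>n. real_cond_exp M F (?term k) \<omega>)"
    by (intro real_cond_exp_sum_at) auto
  ultimately show ?thesis
    unfolding binomial_ring mult.assoc
    by eventually_elim (auto intro!: sum.cong)
qed

end

section \<open>Conditional kurtosis of an independent sum\<close>

text \<open>Additivity of the fourth cumulant: \<open>p + 6 a b + q - 3 (a + b)\<^sup>2\<close> equals
  \<open>(p - 3 a\<^sup>2) + (q - 3 b\<^sup>2)\<close>.\<close>

lemma excess_kurtosis_add_algebra:
  fixes a b p q :: real
  assumes "0 < a" "0 < b"
  shows "(p + 6 * a * b + q) / (a + b)\<^sup>2 - 3 =
    (a / (a + b))\<^sup>2 * (p / a\<^sup>2 - 3) + (b / (a + b))\<^sup>2 * (q / b\<^sup>2 - 3)"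
proof -
  have "(x / s)\<^sup>2 * (m / x\<^sup>2 - 3) = (m - 3 * x\<^sup>2) / s\<^sup>2" if "0 < x" for x s m :: real
    using that by (simp add: power_divide diff_divide_distrib right_diff_distrib)
  moreover have "(p + 6 * a * b + q) / (a + b)\<^sup>2 - 3 = (p - 3 * a\<^sup>2) / (a + b)\<^sup>2 + (q - 3 * b\<^sup>2) / (a + b)\<^sup>2"
  proof -
    have "(a + b)\<^sup>2 \<noteq> 0" using assms by simp
    then have "(p + 6 * a * b + q) / (a + b)\<^sup>2 - 3 = (p + 6 * a * b + q - 3 * (a + b)\<^sup>2) / (a + b)\<^sup>2"
      by (simp add: diff_divide_distrib)
    also have "p + 6 * a * b + q - 3 * (a + b)\<^sup>2 = (p - 3 * a\<^sup>2) + (q - 3 * b\<^sup>2)"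
      by (simp add: power2_sum)
    finally show ?thesis by (simp add: add_divide_distrib)
  qed
  ultimately show ?thesis using assms by simp
qed

text \<open>Squared shares sum to at most 1, so with \<open>y \<ge> 0\<close> replacing \<open>x\<close> by \<open>y\<close> leaves at most \<open>y\<close>. The sign
  condition matters: a negative \<open>y\<close> would be raised by the mixing.\<close>

lemma weighted_sum_le:
  fixes v w x y :: real
  assumes "0 \<le> v" "0 \<le> w" "v + w = 1" "0 \<le> y" "x \<le> y"
  shows "v\<^sup>2 * x + w\<^sup>2 * y \<le> y"
proof -
  have "v\<^sup>2 * x + w\<^sup>2 * y \<le> (v\<^sup>2 + w\<^sup>2) * y"
    using assms by (simp add: distrib_right mult_left_mono)
  also have "v\<^sup>2 + w\<^sup>2 \<le> 1"
  proof -
    have "v\<^sup>2 + w\<^sup>2 \<le> (v + w)\<^sup>2" using assms(1,2) by (simp add: power2_sum)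
    then show ?thesis by (simp only: assms(3) power_one)
  qed
  then have "(v\<^sup>2 + w\<^sup>2) * y \<le> y" using assms(4) mult_right_mono[of "v\<^sup>2 + w\<^sup>2" 1 y] by (simp only: mult_1)
  finally show ?thesis .
qed

lemma dilution_strict:
  fixes w k n r :: real
  assumes "0 < w" "w < 1" "r = w\<^sup>2 * k + (1 - w)\<^sup>2 * n" "0 < k" "n = 0"
  shows "0 < r \<and> r = w\<^sup>2 * k \<and> w\<^sup>2 * k < k \<and> r < k"
  using assms mult_strict_right_mono[of "w\<^sup>2" 1 k] by (auto simp: power_less_one_iff)

text \<open>Centering has to be an almost sure property and not one of a single history: the conditional mean is
  subtracted inside the conditional expectation, which sees all histories at once.\<close>

definition cond_centered_real :: "'a measure \<Rightarrow> 'a measure \<Rightarrow> ('a \<Rightarrow> real) \<Rightarrow> bool" where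
  "cond_centered_real M G X \<longleftrightarrow> X \<in> borel_measurable M \<and>
     (AE \<omega> in M. cond_integrable_at M G X \<omega>) \<and> (AE \<omega> in M. real_cond_exp M G X \<omega> = 0)"

context sigma_finite_subalgebra
begin

lemma cond_centered_real_add:
  assumes "cond_centered_real M F X" "cond_centered_real M F Y"
  shows "cond_centered_real M F (\<lambda>x. X x + Y x)"
proof -
  from assms have m: "X \<in> borel_measurable M" "Y \<in> borel_measurable M"
    by (auto simp: cond_centered_real_def)
  then have "(\<lambda>x. X x + Y x) \<in> borel_measurable M" by measurable
  with assms cond_integrable_at_add[OF m] real_cond_exp_add_at[OF m] show ?thesis
    by (auto simp: cond_centered_real_def)
qed

lemma cond_centered_real_measurable_mult:
  assumes "cond_centered_real M F X" "c \<in> borel_measurable F"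
  shows "cond_centered_real M F (\<lambda>x. c x * X x)"
proof -
  from assms have m: "X \<in> borel_measurable M"
    by (auto simp: cond_centered_real_def)
  with measurable_from_subalg[OF subalg assms(2)] have "(\<lambda>x. c x * X x) \<in> borel_measurable M"
    by measurable
  with assms cond_integrable_at_measurable_mult[OF assms(2) m] real_cond_exp_measurable_mult[OF assms(2) m]
  show ?thesis
    by (auto simp: cond_centered_real_def)
qed

lemma cond_centered_inner:
  fixes X :: "'a \<Rightarrow> real^'n"
  assumes "cond_centered M F X"
  shows "cond_centered_real M F (\<lambda>x. u \<bullet> X x)"
proof -
  from assms have [measurable]: "X \<in> borel_measurable M" by (simp add: cond_centered_def)
  have comp: "cond_centered_real M F (\<lambda>x. X x $ i)" for i
  proof -
    have "(\<lambda>x. X x \<bullet> axis i 1) \<in> borel_measurable M" by measurable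
    then have [measurable]: "(\<lambda>x. X x $ i) \<in> borel_measurable M" by (simp add: inner_axis)
    have "AE \<omega> in M. cond_integrable_at M F (\<lambda>x. norm (X x)) \<omega>"
      using assms by (simp add: cond_centered_def cond_integrable_at_def)
    moreover have "AE \<omega> in M. cond_integrable_at M F (\<lambda>x. norm (X x)) \<omega> \<longrightarrow> cond_integrable_at M F (\<lambda>x. X x $ i) \<omega>"
      by (rule cond_integrable_at_mono) (auto simp: component_le_norm_cart)
    moreover have "AE \<omega> in M. cond_mean M F X \<omega> = 0" using assms by (simp add: cond_centered_def)
    ultimately have "AE \<omega> in M. cond_integrable_at M F (\<lambda>x. X x $ i) \<omega> \<and> real_cond_exp M F (\<lambda>x. X x $ i) \<omega> = 0"
      by eventually_elim (auto simp: cond_mean_def vec_eq_iff)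
    then show ?thesis by (simp add: cond_centered_real_def)
  qed
  have "cond_centered_real M F (\<lambda>x. \<Sum>i\<in>I. u $ i * X x $ i)" if "finite I" for I
    using that
  proof (induction I)
    case empty
    show ?case
      using cond_integrable_at_const[of 0] real_cond_exp_const[of 0] by (simp add: cond_centered_real_def)
  next
    case (insert i I)
    then show ?case
      using cond_centered_real_add[OF cond_centered_real_measurable_mult[OF comp] insert.IH] by simp
  qed
  then show ?thesis by (simp add: inner_vec_def)
qed

lemma cond_central_moment_centered:
  assumes "cond_centered_real M F X"
  shows "AE \<omega> in M. real_cond_exp M F (\<lambda>x. (X x - real_cond_exp M F X x) ^ k) \<omega> =
    real_cond_exp M F (\<lambda>x. X x ^ k) \<omega>"
proof -
  from assms have [measurable]: "X \<in> borel_measurable M" by (auto simp: cond_centered_real_def)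
  show ?thesis
    using assms by (intro real_cond_exp_cong) (auto simp: cond_centered_real_def)
qed

text \<open>Stated for a factor that is only known given the history, because the recovery gain is such a factor.\<close>

lemma cond_central_moment_scale:
  assumes [measurable]: "X \<in> borel_measurable M" "c \<in> borel_measurable F"
  shows "AE \<omega> in M. real_cond_exp M F (\<lambda>x. (c x * X x - real_cond_exp M F (\<lambda>x. c x * X x) x) ^ k) \<omega> =
    c \<omega> ^ k * real_cond_exp M F (\<lambda>x. (X x - real_cond_exp M F X x) ^ k) \<omega>"
proof -
  have [measurable]: "c \<in> borel_measurable M" by (rule measurable_from_subalg[OF subalg]) fact
  have "AE \<omega> in M. real_cond_exp M F (\<lambda>x. (c x * X x - real_cond_exp M F (\<lambda>x. c x * X x) x) ^ k) \<omega> =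
      real_cond_exp M F (\<lambda>x. c x ^ k * (X x - real_cond_exp M F X x) ^ k) \<omega>"
    using real_cond_exp_measurable_mult[OF assms(2,1)]
    by (intro real_cond_exp_cong) (auto simp: power_mult_distrib[symmetric] right_diff_distrib)
  moreover have "AE \<omega> in M. real_cond_exp M F (\<lambda>x. c x ^ k * (X x - real_cond_exp M F X x) ^ k) \<omega> =
      c \<omega> ^ k * real_cond_exp M F (\<lambda>x. (X x - real_cond_exp M F X x) ^ k) \<omega>"
    by (rule real_cond_exp_measurable_mult) auto
  ultimately show ?thesis by eventually_elim simp
qed

lemma cond_var_scale:
  assumes "X \<in> borel_measurable M" "c \<in> borel_measurable F"
  shows "AE \<omega> in M. cond_var M F (\<lambda>x. c x * X x) \<omega> = (c \<omega>)\<^sup>2 * cond_var M F X \<omega>"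
  using cond_central_moment_scale[OF assms, of 2] by (simp add: cond_var_def)

lemma cond_kurt_scale:
  assumes "X \<in> borel_measurable M" "c \<in> borel_measurable F" "AE \<omega> in M. c \<omega> \<noteq> 0"
  shows "AE \<omega> in M. cond_kurt M F (\<lambda>x. c x * X x) \<omega> = cond_kurt M F X \<omega>"
  using cond_central_moment_scale[OF assms(1,2), of 4] cond_var_scale[OF assms(1,2)] assms(3)
proof eventually_elim
  case (elim \<omega>)
  then show ?case
    by (simp add: cond_kurt_def power_mult_distrib power_mult[symmetric])
qed

lemma cond_kurt_definedD:
  assumes [measurable]: "X \<in> borel_measurable M"
  shows "AE \<omega> in M. cond_kurt_defined M F X \<omega> \<longrightarrow>
    0 < cond_var M F X \<omega> \<and> cond_integrable_at M F (\<lambda>x. X x ^ 4) \<omega> \<and>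
    cond_integrable_at M F (\<lambda>x. (X x)\<^sup>2) \<omega>"
  using cond_integrable_at_power_le[OF assms, of 2 4]
  by (auto simp: cond_kurt_defined_def cond_integrable_at_def)

lemma cond_kurt_defined_scale:
  assumes [measurable]: "X \<in> borel_measurable M" "c \<in> borel_measurable F" and "AE \<omega> in M. c \<omega> \<noteq> 0"
  shows "AE \<omega> in M. cond_kurt_defined M F X \<omega> \<longrightarrow> cond_kurt_defined M F (\<lambda>x. c x * X x) \<omega>"
proof -
  have "AE \<omega> in M. cond_integrable_at M F (\<lambda>x. X x ^ 4) \<omega> \<longrightarrow> cond_integrable_at M F (\<lambda>x. c x ^ 4 * X x ^ 4) \<omega>"
    by (rule cond_integrable_at_measurable_mult) auto
  then show ?thesis
    using cond_var_scale[OF assms(1,2)] assms(3)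
    by eventually_elim
       (simp add: cond_kurt_defined_def cond_integrable_at_def power_mult_distrib abs_mult)
qed

lemma cond_var_indep_add:
  fixes X Y :: "'a \<Rightarrow> real^'n" and f g :: "real^'n \<Rightarrow> real"
  assumes m[measurable]: "X \<in> borel_measurable M" "Y \<in> borel_measurable M"
    and indep: "cond_indep M F X Y"
    and fg[measurable]: "f \<in> borel_measurable borel" "g \<in> borel_measurable borel"
    and c: "cond_centered_real M F (\<lambda>x. f (X x))" "cond_centered_real M F (\<lambda>x. g (Y x))"
  shows "AE \<omega> in M. cond_integrable_at M F (\<lambda>x. (f (X x))\<^sup>2) \<omega> \<and> cond_integrable_at M F (\<lambda>x. (g (Y x))\<^sup>2) \<omega> \<longrightarrow>
    cond_var M F (\<lambda>x. f (X x) + g (Y x)) \<omega> = cond_var M F (\<lambda>x. f (X x)) \<omega> + cond_var M F (\<lambda>x. g (Y x)) \<omega>"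
proof -
  have "AE \<omega> in M. real_cond_exp M F (\<lambda>x. f (X x)) \<omega> = 0"
    "AE \<omega> in M. real_cond_exp M F (\<lambda>x. g (Y x)) \<omega> = 0"
    using c by (auto simp: cond_centered_real_def)
  with cond_moment_indep_add[OF m indep fg, of 2] real_cond_exp_const[of 1]
    cond_central_moment_centered[OF c(1), of 2] cond_central_moment_centered[OF c(2), of 2]
    cond_central_moment_centered[OF cond_centered_real_add[OF c], of 2]
  show ?thesis
    unfolding cond_var_def
    by eventually_elim (simp add: numeral_eq_Suc)
qed

text \<open>All terms of the fourth binomial expansion with a first moment vanish, which leaves the two fourth
  moments and \<open>6\<close> times the product of the variances.\<close>

lemma cond_kurt_indep_add:
  fixes X Y :: "'a \<Rightarrow> real^'n" and f g :: "real^'n \<Rightarrow> real"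
  assumes m[measurable]: "X \<in> borel_measurable M" "Y \<in> borel_measurable M"
    and indep: "cond_indep M F X Y"
    and fg[measurable]: "f \<in> borel_measurable borel" "g \<in> borel_measurable borel"
    and c: "cond_centered_real M F (\<lambda>x. f (X x))" "cond_centered_real M F (\<lambda>x. g (Y x))"
  shows "AE \<omega> in M. cond_kurt_defined M F (\<lambda>x. f (X x)) \<omega> \<and> cond_kurt_defined M F (\<lambda>x. g (Y x)) \<omega> \<longrightarrow>
    cond_var M F (\<lambda>x. f (X x) + g (Y x)) \<omega> = cond_var M F (\<lambda>x. f (X x)) \<omega> + cond_var M F (\<lambda>x. g (Y x)) \<omega> \<and>
    0 < cond_share M F (\<lambda>x. f (X x)) (\<lambda>x. g (Y x)) \<omega> \<and> 0 < cond_share M F (\<lambda>x. g (Y x)) (\<lambda>x. f (X x)) \<omega> \<and>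
    cond_share M F (\<lambda>x. f (X x)) (\<lambda>x. g (Y x)) \<omega> + cond_share M F (\<lambda>x. g (Y x)) (\<lambda>x. f (X x)) \<omega> = 1 \<and>
    cond_kurt M F (\<lambda>x. f (X x) + g (Y x)) \<omega> = cond_weighted_kurt M F (\<lambda>x. f (X x)) (\<lambda>x. g (Y x)) \<omega>"
proof -
  have "AE \<omega> in M. real_cond_exp M F (\<lambda>x. f (X x)) \<omega> = 0"
    "AE \<omega> in M. real_cond_exp M F (\<lambda>x. g (Y x)) \<omega> = 0"
    using c by (auto simp: cond_centered_real_def)
  moreover have "AE \<omega> in M. cond_kurt_defined M F (\<lambda>x. f (X x)) \<omega> \<longrightarrow>
      0 < cond_var M F (\<lambda>x. f (X x)) \<omega> \<and> cond_integrable_at M F (\<lambda>x. f (X x) ^ 4) \<omega> \<and>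
      cond_integrable_at M F (\<lambda>x. (f (X x))\<^sup>2) \<omega>"
    "AE \<omega> in M. cond_kurt_defined M F (\<lambda>x. g (Y x)) \<omega> \<longrightarrow>
      0 < cond_var M F (\<lambda>x. g (Y x)) \<omega> \<and> cond_integrable_at M F (\<lambda>x. g (Y x) ^ 4) \<omega> \<and>
      cond_integrable_at M F (\<lambda>x. (g (Y x))\<^sup>2) \<omega>"
    by (rule cond_kurt_definedD; measurable)+
  ultimately show ?thesis
    using cond_moment_indep_add[OF m indep fg, of 4] real_cond_exp_const[of 1]
      cond_central_moment_centered[OF c(1), of 2] cond_central_moment_centered[OF c(2), of 2]
      cond_central_moment_centered[OF c(1), of 4] cond_central_moment_centered[OF c(2), of 4]
      cond_central_moment_centered[OF cond_centered_real_add[OF c], of 4]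
      cond_var_indep_add[OF m indep fg c]
  proof eventually_elim
    case (elim \<omega>)
    show ?case
    proof (intro impI)
      assume def: "cond_kurt_defined M F (\<lambda>x. f (X x)) \<omega> \<and> cond_kurt_defined M F (\<lambda>x. g (Y x)) \<omega>"
      let ?a = "cond_var M F (\<lambda>x. f (X x)) \<omega>" and ?b = "cond_var M F (\<lambda>x. g (Y x)) \<omega>"
      let ?m = "\<lambda>Z. real_cond_exp M F (\<lambda>x. Z x ^ 4) \<omega>"
      from def elim have pos: "0 < ?a" "0 < ?b" by blast+
      from def elim have var: "cond_var M F (\<lambda>x. f (X x) + g (Y x)) \<omega> = ?a + ?b" by blast
      have "?m (\<lambda>x. f (X x) + g (Y x)) =
         (\<Sum>k\<le>4. of_nat (4 choose k) * real_cond_exp M F (\<lambda>x. f (X x) ^ k) \<omega> * real_cond_exp M F (\<lambda>x. g (Y x) ^ (4 - k)) \<omega>)"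
        using def elim(3,4,5) by blast
      also have "\<dots> = ?m (\<lambda>x. f (X x)) + 6 * ?a * ?b + ?m (\<lambda>x. g (Y x))"
        using elim(1,2,6,7,8) by (simp add: cond_var_def numeral_eq_Suc)
      finally have m4: "?m (\<lambda>x. f (X x) + g (Y x)) = ?m (\<lambda>x. f (X x)) + 6 * ?a * ?b + ?m (\<lambda>x. g (Y x))" .
      have share: "cond_share M F (\<lambda>x. f (X x)) (\<lambda>x. g (Y x)) \<omega> = ?a / (?a + ?b)"
          "cond_share M F (\<lambda>x. g (Y x)) (\<lambda>x. f (X x)) \<omega> = ?b / (?a + ?b)"
        using var by (simp_all add: cond_share_def add.commute)
      have "cond_kurt M F (\<lambda>x. f (X x) + g (Y x)) \<omega> = cond_weighted_kurt M F (\<lambda>x. f (X x)) (\<lambda>x. g (Y x)) \<omega>"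
        unfolding cond_weighted_kurt_def share cond_kurt_def var elim(9,10,11) m4
        by (rule excess_kurtosis_add_algebra[OF pos])
      moreover have "?a / (?a + ?b) + ?b / (?a + ?b) = 1"
        using pos by (simp add: add_divide_distrib[symmetric])
      ultimately show "cond_var M F (\<lambda>x. f (X x) + g (Y x)) \<omega> = ?a + ?b \<and>
          0 < cond_share M F (\<lambda>x. f (X x)) (\<lambda>x. g (Y x)) \<omega> \<and>
          0 < cond_share M F (\<lambda>x. g (Y x)) (\<lambda>x. f (X x)) \<omega> \<and>
          cond_share M F (\<lambda>x. f (X x)) (\<lambda>x. g (Y x)) \<omega> + cond_share M F (\<lambda>x. g (Y x)) (\<lambda>x. f (X x)) \<omega> = 1 \<and>
          cond_kurt M F (\<lambda>x. f (X x) + g (Y x)) \<omega> = cond_weighted_kurt M F (\<lambda>x. f (X x)) (\<lambda>x. g (Y x)) \<omega>"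
        using pos by (simp add: share var)
    qed
  qed
qed

text \<open>The standardizing factor is known given the history and can be pulled out, so kurtosis depends only
  on the conditional law of the standardized variable. Where the variance vanishes both
  sides are \<open>- 3\<close>, because division by 0 gives 0.\<close>

lemma cond_kurt_eq_standardized_moment:
  assumes [measurable]: "X \<in> borel_measurable M"
  shows "AE \<omega> in M. cond_kurt M F X \<omega> =
    enn2real (nn_cond_exp M F (\<lambda>x. ennreal (cond_standardize M F X x ^ 4)) \<omega>) - 3"
proof -
  have [measurable]: "cond_var M F X \<in> borel_measurable F"
    unfolding cond_var_def by measurable
  have std4: "(\<lambda>x. cond_standardize M F X x ^ 4) =
      (\<lambda>x. (1 / (cond_var M F X x)\<^sup>2) * (X x - real_cond_exp M F X x) ^ 4)"
  proof
    fix x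
    have "sqrt (cond_var M F X x) ^ 4 = ((sqrt (cond_var M F X x))\<^sup>2)\<^sup>2"
      by (simp flip: power_mult)
    also have "\<dots> = (cond_var M F X x)\<^sup>2" by (simp add: real_sqrt_abs2 power2_eq_square)
    finally show "cond_standardize M F X x ^ 4 =
        (1 / (cond_var M F X x)\<^sup>2) * (X x - real_cond_exp M F X x) ^ 4"
      by (simp add: cond_standardize_def power_divide)
  qed
  have "AE \<omega> in M. real_cond_exp M F (\<lambda>x. (1 / (cond_var M F X x)\<^sup>2) * (X x - real_cond_exp M F X x) ^ 4) \<omega> =
      (1 / (cond_var M F X \<omega>)\<^sup>2) * real_cond_exp M F (\<lambda>x. (X x - real_cond_exp M F X x) ^ 4) \<omega>"
    by (rule real_cond_exp_measurable_mult) measurable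
  moreover have "AE \<omega> in M. real_cond_exp M F (\<lambda>x. cond_standardize M F X x ^ 4) \<omega> =
      enn2real (nn_cond_exp M F (\<lambda>x. ennreal (cond_standardize M F X x ^ 4)) \<omega>)"
    by (rule real_cond_exp_eq_enn2real) simp
  ultimately show ?thesis
    unfolding std4 by eventually_elim (simp add: cond_kurt_def)
qed

lemma cond_kurt_same_std_law:
  assumes [measurable]: "X \<in> borel_measurable M" "Y \<in> borel_measurable M"
    and same: "cond_same_std_law M F A X Y"
  shows "AE \<omega> in M. \<omega> \<in> A \<longrightarrow> cond_kurt M F X \<omega> = cond_kurt M F Y \<omega>"
proof -
  have [measurable]: "cond_standardize M F Z \<in> borel_measurable M"
    if [measurable]: "Z \<in> borel_measurable M" for Z
    unfolding cond_standardize_def[abs_def] cond_var_def by measurable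
  have "AE \<omega> in M. nn_cond_exp M F (\<lambda>x. ennreal (cond_standardize M F X x ^ 4) * 1) \<omega> * indicator A \<omega> =
      nn_cond_exp M F (\<lambda>x. ennreal (cond_standardize M F Y x ^ 4) * 1) \<omega> * indicator A \<omega>"
  proof (rule nn_cond_exp_transfer[where f="\<lambda>y. ennreal (y ^ 4)"])
    fix B :: "real set" assume B[measurable]: "B \<in> sets borel"
    have "AE \<omega> in M. nn_cond_exp M F (\<lambda>x. indicator B (cond_standardize M F Z x) * 1) \<omega> =
        ennreal (cond_prob_given M F {x \<in> space M. cond_standardize M F Z x \<in> B} \<omega>) \<and>
        0 \<le> cond_prob_given M F {x \<in> space M. cond_standardize M F Z x \<in> B} \<omega>"
      if [measurable]: "Z \<in> borel_measurable M" for Z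
      by (rule nn_cond_exp_eq_cond_prob) (auto simp: indicator_def)
    from this[OF assms(1)] this[OF assms(2)]
    show "AE \<omega> in M. nn_cond_exp M F (\<lambda>x. indicator B (cond_standardize M F X x) * 1) \<omega> * indicator A \<omega> =
        nn_cond_exp M F (\<lambda>x. indicator B (cond_standardize M F Y x) * 1) \<omega> * indicator A \<omega>"
      using same[unfolded cond_same_std_law_def, rule_format, OF B]
      by eventually_elim (auto simp: indicator_def)
  qed measurable
  then show ?thesis
    using cond_kurt_eq_standardized_moment[OF assms(1)] cond_kurt_eq_standardized_moment[OF assms(2)]
    by eventually_elim (auto simp: indicator_def)
qed

end

lemma borel_measurable_cond_kurt: "cond_kurt M G X \<in> borel_measurable M"
  unfolding cond_kurt_def[abs_def] cond_var_def by measurable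

lemma borel_measurable_cond_weighted_kurt: "cond_weighted_kurt M G X Y \<in> borel_measurable M"
proof -
  note [measurable] = borel_measurable_cond_kurt
  have [measurable]: "cond_share M G X Y \<in> borel_measurable M" for X Y
    unfolding cond_share_def[abs_def] cond_var_def by measurable
  show ?thesis unfolding cond_weighted_kurt_def[abs_def] by measurable
qed

section \<open>Kurtosis under a law\<close>

context prob_space
begin

lemma integrable_power_le:
  fixes X :: "'a \<Rightarrow> real"
  assumes [measurable]: "X \<in> borel_measurable M" and "integrable M (\<lambda>x. X x ^ n)" and "k \<le> n"
  shows "integrable M (\<lambda>x. X x ^ k)"
proof (rule Bochner_Integration.integrable_bound[of _ "\<lambda>x. 1 + \<bar>X x ^ n\<bar>"])
  have "\<bar>X x\<bar> ^ k \<le> 1 + \<bar>X x\<bar> ^ n" for x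
  proof (cases "\<bar>X x\<bar> \<le> 1")
    case True
    then show ?thesis by (simp add: power_le_one add_increasing2)
  next
    case False
    then have "\<bar>X x\<bar> ^ k \<le> \<bar>X x\<bar> ^ n" using \<open>k \<le> n\<close> by (intro power_increasing) auto
    then show ?thesis by simp
  qed
  then show "AE x in M. norm (X x ^ k) \<le> norm (1 + \<bar>X x ^ n\<bar>)"
    by (simp add: power_abs)
qed (use assms in auto)

lemma moment_indep_add:
  fixes X Y :: "'a \<Rightarrow> real"
  assumes [measurable]: "X \<in> borel_measurable M" "Y \<in> borel_measurable M"
    and indep: "indep_var borel X borel Y"
    and "integrable M (\<lambda>x. X x ^ n)" "integrable M (\<lambda>x. Y x ^ n)"
  shows "(LINT x|M. (X x + Y x) ^ n) =
    (\<Sum>k\<le>n. of_nat (n choose k) * (LINT x|M. X x ^ k) * (LINT x|M. Y x ^ (n - k)))"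
proof -
  have "integrable M (\<lambda>x. X x ^ k * Y x ^ (n - k)) \<and>
      (LINT x|M. X x ^ k * Y x ^ (n - k)) = (LINT x|M. X x ^ k) * (LINT x|M. Y x ^ (n - k))" if "k \<le> n" for k
  proof -
    have "indep_var borel (\<lambda>x. X x ^ k) borel (\<lambda>x. Y x ^ (n - k))"
      using indep_var_compose[OF indep, of "\<lambda>x. x ^ k" borel "\<lambda>x. x ^ (n - k)" borel] by (simp add: comp_def)
    moreover have "integrable M (\<lambda>x. X x ^ k)" "integrable M (\<lambda>x. Y x ^ (n - k))"
      using that assms by (auto intro: integrable_power_le)
    ultimately show ?thesis
      by (simp add: indep_var_integrable indep_var_lebesgue_integral)
  qed
  then show ?thesis
    unfolding binomial_ring
    by (subst Bochner_Integration.integral_sum) (auto simp: mult.assoc intro!: sum.cong)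
qed

lemma law_var_scale: "law_var M (\<lambda>x. c * X x) = c\<^sup>2 * law_var M X"
  by (simp add: law_var_def power_mult_distrib flip: right_diff_distrib)

lemma kurt_scale: "c \<noteq> 0 \<Longrightarrow> kurt M (\<lambda>x. c * X x) = kurt M X"
  by (simp add: kurt_def law_var_scale power_mult_distrib flip: right_diff_distrib power_mult)

lemma indep_centered_scale:
  assumes "indep_centered M X Y" "a \<noteq> 0" "b \<noteq> 0"
  shows "indep_centered M (\<lambda>x. a * X x) (\<lambda>x. b * Y x)"
proof -
  have "indep_var borel (\<lambda>x. a * X x) borel (\<lambda>x. b * Y x)"
    using indep_var_compose[of borel X borel Y "\<lambda>x. a * x" borel "\<lambda>x. b * x" borel] assms(1)
    by (simp add: comp_def indep_centered_def)
  then show ?thesis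
    using assms by (auto simp: indep_centered_def kurt_defined_def law_var_scale power_mult_distrib)
qed

lemma kurt_indep_add:
  assumes "indep_centered M X Y"
  shows "law_var M (\<lambda>x. X x + Y x) = law_var M X + law_var M Y"
    and "0 < share M X Y" "0 < share M Y X" "share M X Y + share M Y X = 1"
    and "kurt M (\<lambda>x. X x + Y x) = weighted_kurt M X Y"
proof -
  from assms have m[measurable]: "X \<in> borel_measurable M" "Y \<in> borel_measurable M"
    and indep: "indep_var borel X borel Y"
    and i4: "integrable M (\<lambda>x. X x ^ 4)" "integrable M (\<lambda>x. Y x ^ 4)"
    and pos: "0 < law_var M X" "0 < law_var M Y"
    and zero: "(LINT x|M. X x) = 0" "(LINT x|M. Y x) = 0"
    by (auto simp: indep_centered_def kurt_defined_def)
  have i2: "integrable M (\<lambda>x. (X x)\<^sup>2)" "integrable M (\<lambda>x. (Y x)\<^sup>2)"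
    using integrable_power_le[OF m(1) i4(1), of 2] integrable_power_le[OF m(2) i4(2), of 2] by auto
  have i1: "integrable M X" "integrable M Y"
    using integrable_power_le[OF m(1) i4(1), of 1] integrable_power_le[OF m(2) i4(2), of 1] by auto
  have sum0: "(LINT x|M. X x + Y x) = 0" using i1 zero by simp
  show var: "law_var M (\<lambda>x. X x + Y x) = law_var M X + law_var M Y"
    using moment_indep_add[OF m indep i2] zero sum0
    by (simp add: law_var_def numeral_eq_Suc prob_space)
  have share: "share M X Y = law_var M X / (law_var M X + law_var M Y)"
    "share M Y X = law_var M Y / (law_var M X + law_var M Y)"
    using var by (simp_all add: share_def add.commute)
  with pos show "0 < share M X Y" "0 < share M Y X" "share M X Y + share M Y X = 1"
    by (auto simp: add_divide_distrib[symmetric])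
  have m4: "(LINT x|M. (X x + Y x) ^ 4) =
      (LINT x|M. X x ^ 4) + 6 * law_var M X * law_var M Y + (LINT x|M. Y x ^ 4)"
    using moment_indep_add[OF m indep i4] zero
    by (simp add: law_var_def numeral_eq_Suc prob_space)
  show "kurt M (\<lambda>x. X x + Y x) = weighted_kurt M X Y"
    unfolding weighted_kurt_def share kurt_def var zero sum0 diff_zero m4
    by (rule excess_kurtosis_add_algebra[OF pos])
qed

lemma kurt_eq_standardized_moment: "kurt M X = (LINT x|M. standardize M X x ^ 4) - 3"
proof -
  have "sqrt (law_var M X) ^ 4 = ((sqrt (law_var M X))\<^sup>2)\<^sup>2"
    by (simp flip: power_mult)
  also have "\<dots> = (law_var M X)\<^sup>2" by (simp add: power2_eq_square)
  finally show ?thesis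
    by (simp add: kurt_def standardize_def power_divide)
qed

lemma kurt_same_std_law:
  assumes [measurable]: "X \<in> borel_measurable M" "Y \<in> borel_measurable M" and "same_std_law M X Y"
  shows "kurt M X = kurt M Y"
proof -
  have "(LINT x|M. standardize M Z x ^ 4) = (LINT y|distr M borel (standardize M Z). y ^ 4)"
    if [measurable]: "Z \<in> borel_measurable M" for Z
    unfolding standardize_def[abs_def] by (subst integral_distr) auto
  with assms show ?thesis by (simp add: kurt_eq_standardized_moment same_std_law_def)
qed

end

section \<open>Windows\<close>

lemma prob_space_window_law: "window M W \<Longrightarrow> prob_space (window_law M W)"
  unfolding window_def window_law_def
  by (intro prob_space_uniform_measure) auto

lemma measurable_window_law:
  assumes "\<And>t. 1 \<le> t \<Longrightarrow> f t \<in> borel_measurable M"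
  shows "(\<lambda>p. f (fst p) (snd p)) \<in> borel_measurable (window_law M W)"
proof -
  have "(\<lambda>p. f (fst p) (snd p)) \<in> borel_measurable (count_space {1..} \<Otimes>\<^sub>M M)"
    by (rule measurable_pair_measure_countable1) (use assms in auto)
  then show ?thesis by (simp add: window_law_def)
qed

text \<open>The exceptional null sets of the countably many steps are stacked into one null set of the product.\<close>

lemma AE_window_law:
  assumes "prob_space M" "window M W" "\<And>t. 1 \<le> t \<Longrightarrow> AE \<omega> in M. P t \<omega>"
  shows "AE p in window_law M W. P (fst p) (snd p)"
proof -
  interpret prob_space M by fact
  let ?C = "count_space {1..} :: nat measure"
  have "\<forall>t\<in>{1..}. \<exists>N\<in>null_sets M. {\<omega>\<in>space M. \<not> P t \<omega>} \<subseteq> N"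
    using assms(3) by (fastforce simp: eventually_ae_filter)
  then obtain N where N: "\<And>t. 1 \<le> t \<Longrightarrow> N t \<in> null_sets M" "\<And>t. 1 \<le> t \<Longrightarrow> {\<omega>\<in>space M. \<not> P t \<omega>} \<subseteq> N t"
    by (metis atLeast_iff)
  have "{t} \<times> N t \<in> null_sets (?C \<Otimes>\<^sub>M M)" if "1 \<le> t" for t
    using N(1)[OF that] that by (auto simp: null_sets_def emeasure_pair_measure_Times)
  then have "(\<Union>t\<in>{1..}. {t} \<times> N t) \<in> null_sets (?C \<Otimes>\<^sub>M M)"
    by (intro null_sets_UN') auto
  moreover have "{p\<in>space (?C \<Otimes>\<^sub>M M). \<not> P (fst p) (snd p)} \<subseteq> (\<Union>t\<in>{1..}. {t} \<times> N t)"
    using N(2) by (fastforce simp: space_pair_measure)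
  ultimately have "AE p in ?C \<Otimes>\<^sub>M M. P (fst p) (snd p)"
    by (auto simp: eventually_ae_filter)
  then show ?thesis
    using assms(2) unfolding window_law_def window_def
    by (subst AE_uniform_measure) auto
qed

lemma window_avg_cong:
  assumes "\<And>t. 1 \<le> t \<Longrightarrow> f t \<in> borel_measurable M" "\<And>t. 1 \<le> t \<Longrightarrow> g t \<in> borel_measurable M"
    and "AE p in window_law M W. f (fst p) (snd p) = g (fst p) (snd p)"
  shows "window_avg M W f = window_avg M W g"
  unfolding window_avg_def
  using assms by (intro integral_cong_AE measurable_window_law) auto

section \<open>Traces of conditional covariances\<close>

lemma step_trace_eq_sum_cond_var:
  "step_trace M F X t \<omega> = (\<Sum>i\<in>UNIV. cond_var M (F (t - 1)) (\<lambda>x. X t x $ i) \<omega>)"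
  by (simp add: step_trace_def step_cov_def cond_cov_def trace_def cond_var_def cond_mean_def power2_eq_square)

lemma borel_measurable_step_trace: "step_trace M F X t \<in> borel_measurable M"
  unfolding step_trace_eq_sum_cond_var[abs_def] cond_var_def by measurable

lemma sigma_finite_subalgebra_of_prob_space:
  "prob_space M \<Longrightarrow> subalgebra M G \<Longrightarrow> sigma_finite_subalgebra M G"
  by (intro finite_measure_subalgebra_is_sigma_finite)
     (simp add: finite_measure_subalgebra_def finite_measure_subalgebra_axioms_def prob_space.finite_measure)

context sigma_finite_subalgebra
begin

lemma cond_var_nonneg: "AE \<omega> in M. 0 \<le> cond_var M F X \<omega>"
  using real_cond_exp_eq_enn2real[of "\<lambda>x. (X x - real_cond_exp M F X x)\<^sup>2"]
  by (auto simp: cond_var_def)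

text \<open>A coordinate of a vector is its projection on an axis, so the scalar results apply to it. Here
  second moments are finite at almost every history, by the finite conditional covariances.\<close>

lemma cond_var_component_combination:
  fixes X Y :: "'a \<Rightarrow> real^'n"
  assumes X: "cond_centered M F X" "cond_finite_cov M F X" and Y: "cond_centered M F Y" "cond_finite_cov M F Y"
    and indep: "cond_indep M F X Y" and c: "c \<in> borel_measurable F"
  shows "AE \<omega> in M. cond_var M F (\<lambda>x. (c x *\<^sub>R (a *\<^sub>R X x + b *\<^sub>R Y x)) $ i) \<omega> =
    (c \<omega>)\<^sup>2 * (a\<^sup>2 * cond_var M F (\<lambda>x. X x $ i) \<omega> + b\<^sup>2 * cond_var M F (\<lambda>x. Y x $ i) \<omega>)"
proof -
  have m[measurable]: "X \<in> borel_measurable M" "Y \<in> borel_measurable M"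
    using X Y by (auto simp: cond_centered_def)
  \<comment> \<open>coordinates as projections, to fit the form of the independence lemmas\<close>
  define e where "e = (axis i 1 :: real^'n)"
  have e: "z $ i = e \<bullet> z" for z by (simp add: e_def inner_axis')
  have sq: "AE \<omega> in M. cond_integrable_at M F (\<lambda>x. (r * (e \<bullet> Z x))\<^sup>2) \<omega>"
    if Z: "cond_centered M F Z" "cond_finite_cov M F Z" for Z :: "'a \<Rightarrow> real^'n" and r
  proof -
    have [measurable]: "Z \<in> borel_measurable M" using Z by (simp add: cond_centered_def)
    have "\<bar>(e \<bullet> Z x)\<^sup>2\<bar> \<le> \<bar>(norm (Z x))\<^sup>2\<bar>" for x
      by (simp add: e[symmetric] component_le_norm_cart abs_le_square_iff[symmetric])
    then have "AE \<omega> in M. cond_integrable_at M F (\<lambda>x. (norm (Z x))\<^sup>2) \<omega> \<longrightarrow> cond_integrable_at M F (\<lambda>x. (e \<bullet> Z x)\<^sup>2) \<omega>"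
      by (rule cond_integrable_at_mono) measurable
    moreover have "AE \<omega> in M. cond_integrable_at M F (\<lambda>x. (e \<bullet> Z x)\<^sup>2) \<omega> \<longrightarrow>
        cond_integrable_at M F (\<lambda>x. r\<^sup>2 * (e \<bullet> Z x)\<^sup>2) \<omega>"
      by (rule cond_integrable_at_measurable_mult) auto
    moreover have "AE \<omega> in M. cond_integrable_at M F (\<lambda>x. (norm (Z x))\<^sup>2) \<omega>"
      using Z by (simp add: cond_finite_cov_def cond_integrable_at_def)
    ultimately show ?thesis by eventually_elim (simp add: power_mult_distrib)
  qed
  have "AE \<omega> in M. cond_var M F (\<lambda>x. c x * (a * (e \<bullet> X x) + b * (e \<bullet> Y x))) \<omega> =
      (c \<omega>)\<^sup>2 * cond_var M F (\<lambda>x. a * (e \<bullet> X x) + b * (e \<bullet> Y x)) \<omega>"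
    "AE \<omega> in M. cond_var M F (\<lambda>x. a * (e \<bullet> X x)) \<omega> = a\<^sup>2 * cond_var M F (\<lambda>x. e \<bullet> X x) \<omega>"
    "AE \<omega> in M. cond_var M F (\<lambda>x. b * (e \<bullet> Y x)) \<omega> = b\<^sup>2 * cond_var M F (\<lambda>x. e \<bullet> Y x) \<omega>"
    by (rule cond_var_scale; use c in measurable)+
  moreover have "AE \<omega> in M. cond_integrable_at M F (\<lambda>x. (a * (e \<bullet> X x))\<^sup>2) \<omega> \<and>
      cond_integrable_at M F (\<lambda>x. (b * (e \<bullet> Y x))\<^sup>2) \<omega> \<longrightarrow>
      cond_var M F (\<lambda>x. a * (e \<bullet> X x) + b * (e \<bullet> Y x)) \<omega> =
      cond_var M F (\<lambda>x. a * (e \<bullet> X x)) \<omega> + cond_var M F (\<lambda>x. b * (e \<bullet> Y x)) \<omega>"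
    by (rule cond_var_indep_add[OF m indep])
      (auto intro!: cond_centered_real_measurable_mult cond_centered_inner X Y)
  ultimately show ?thesis
    using sq[OF X, of a] sq[OF Y, of b]
    unfolding e inner_simps real_scaleR_def
    by eventually_elim (simp add: inner_simps)
qed

end

text \<open>The common form of the innovations: \<open>c = 1\<close> and \<open>a = b = 1\<close> describe the forced regime, \<open>c\<close> one
  minus the gain and weights \<open>1 - \<lambda>\<close>, \<open>\<lambda>\<close> the stabilized one.\<close>

lemma step_trace_combination:
  assumes "prob_space M" "\<And>t. subalgebra M (F t)"
    and XY: "channel M F X" "channel M F Y" "channels_cond_indep M F X Y"
    and c: "\<And>t. 1 \<le> t \<Longrightarrow> c t \<in> borel_measurable (F (t - 1))" and "1 \<le> t"
  shows "AE \<omega> in M. step_trace M F (\<lambda>t \<omega>. c t \<omega> *\<^sub>R (a *\<^sub>R X t \<omega> + b *\<^sub>R Y t \<omega>)) t \<omega> =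
    (c t \<omega>)\<^sup>2 * (a\<^sup>2 * step_trace M F X t \<omega> + b\<^sup>2 * step_trace M F Y t \<omega>)"
proof -
  interpret sigma_finite_subalgebra M "F (t - 1)"
    by (rule sigma_finite_subalgebra_of_prob_space) fact+
  have "AE \<omega> in M. \<forall>i\<in>UNIV. cond_var M (F (t - 1)) (\<lambda>x. (c t x *\<^sub>R (a *\<^sub>R X t x + b *\<^sub>R Y t x)) $ i) \<omega> =
    (c t \<omega>)\<^sup>2 * (a\<^sup>2 * cond_var M (F (t - 1)) (\<lambda>x. X t x $ i) \<omega> + b\<^sup>2 * cond_var M (F (t - 1)) (\<lambda>x. Y t x $ i) \<omega>)"
    using XY c \<open>1 \<le> t\<close>
    by (intro AE_finite_allI cond_var_component_combination)
       (auto simp: channel_def channels_cond_indep_def)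
  then show ?thesis
    unfolding step_trace_eq_sum_cond_var
    by eventually_elim (simp add: sum_distrib_left sum.distrib distrib_left mult.assoc)
qed

lemma step_trace_nonneg:
  assumes "prob_space M" "subalgebra M (F (t - 1))"
  shows "AE \<omega> in M. 0 \<le> step_trace M F X t \<omega>"
proof -
  interpret sigma_finite_subalgebra M "F (t - 1)"
    by (rule sigma_finite_subalgebra_of_prob_space) fact+
  have "AE \<omega> in M. \<forall>i\<in>UNIV. 0 \<le> cond_var M (F (t - 1)) (\<lambda>x. X t x $ i) \<omega>"
    by (intro AE_finite_allI cond_var_nonneg) auto
  then show ?thesis
    unfolding step_trace_eq_sum_cond_var by eventually_elim (simp add: sum_nonneg)
qed

section \<open>Uncorrected regimes\<close>

lemma trace_increment_add:
  assumes prob: "prob_space M" and sub: "\<And>t. subalgebra M (F t)"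
    and windows: "window M event" "window M quiet"
    and XY: "channel M F X" "channel M F Y" "channels_cond_indep M F X Y"
    and fin: "finite_traces M F event quiet X" "finite_traces M F event quiet Y"
  shows "trace_increment M F event quiet (\<lambda>t \<omega>. X t \<omega> + Y t \<omega>) =
    trace_increment M F event quiet X + trace_increment M F event quiet Y"
proof -
  have "window_avg M W (step_trace M F (\<lambda>t \<omega>. X t \<omega> + Y t \<omega>)) =
      window_avg M W (step_trace M F X) + window_avg M W (step_trace M F Y)"
    if "window M W" "window_integrable M W (step_trace M F X)" "window_integrable M W (step_trace M F Y)" for W
  proof -
    have "AE p in window_law M W. step_trace M F (\<lambda>t \<omega>. X t \<omega> + Y t \<omega>) (fst p) (snd p) =
        step_trace M F X (fst p) (snd p) + step_trace M F Y (fst p) (snd p)"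
      using step_trace_combination[OF prob sub XY, of "\<lambda>_ _. 1" _ 1 1]
      by (intro AE_window_law[OF prob that(1)]) simp
    then have "window_avg M W (step_trace M F (\<lambda>t \<omega>. X t \<omega> + Y t \<omega>)) =
        window_avg M W (\<lambda>t \<omega>. step_trace M F X t \<omega> + step_trace M F Y t \<omega>)"
      by (intro window_avg_cong) (auto intro: borel_measurable_step_trace borel_measurable_add)
    with that show ?thesis by (simp add: window_avg_def window_integrable_def)
  qed
  with windows fin show ?thesis by (simp add: trace_increment_def finite_traces_def)
qed

lemma pooled_kurt_forced:
  assumes "window M W" and "indep_centered (window_law M W) (pooled_proj u \<zeta>b) (pooled_proj u \<zeta>e)"
  shows "kurt (window_law M W) (pooled_proj u (innovation (Forced \<zeta>e \<zeta>b))) =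
    weighted_kurt (window_law M W) (pooled_proj u \<zeta>b) (pooled_proj u \<zeta>e)"
proof -
  interpret prob_space "window_law M W" by (rule prob_space_window_law) fact
  have "pooled_proj u (innovation (Forced \<zeta>e \<zeta>b)) = (\<lambda>p. pooled_proj u \<zeta>b p + pooled_proj u \<zeta>e p)"
    by (simp add: fun_eq_iff pooled_proj_def inner_add_right)
  then show ?thesis using kurt_indep_add(5)[OF assms(2)] by simp
qed

lemma step_kurt_forced:
  fixes \<zeta>e \<zeta>b :: "nat \<Rightarrow> 'a \<Rightarrow> real^'n" and M :: "'a measure" and u :: "real^'n"
  assumes prob: "prob_space M" and sub: "\<And>t. subalgebra M (F t)"
    and model: "regime_model M F (Forced \<zeta>e \<zeta>b)" and indep: "channels_cond_indep M F \<zeta>e \<zeta>b" and "1 \<le> t"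
  defines "G \<equiv> F (t - 1)" and "B \<equiv> scalar_proj u \<zeta>b t" and "E \<equiv> scalar_proj u \<zeta>e t"
    and "X \<equiv> scalar_proj u (innovation (Forced \<zeta>e \<zeta>b)) t"
  shows "AE \<omega> in M. cond_kurt_defined M G B \<omega> \<and> cond_kurt_defined M G E \<omega> \<longrightarrow>
    0 < cond_share M G B E \<omega> \<and> 0 < cond_share M G E B \<omega> \<and>
    cond_share M G B E \<omega> + cond_share M G E B \<omega> = 1 \<and>
    cond_kurt M G X \<omega> = cond_weighted_kurt M G B E \<omega>"
proof -
  interpret sigma_finite_subalgebra M G
    unfolding G_def by (rule sigma_finite_subalgebra_of_prob_space[OF prob sub])
  have c: "cond_centered M G (\<zeta>e t)" "cond_centered M G (\<zeta>b t)" and i: "cond_indep M G (\<zeta>e t) (\<zeta>b t)"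
    using model indep \<open>1 \<le> t\<close> by (auto simp: channel_def channels_cond_indep_def G_def)
  have "X = (\<lambda>\<omega>. u \<bullet> \<zeta>e t \<omega> + u \<bullet> \<zeta>b t \<omega>)" "B = (\<lambda>\<omega>. u \<bullet> \<zeta>b t \<omega>)" "E = (\<lambda>\<omega>. u \<bullet> \<zeta>e t \<omega>)"
    by (auto simp: X_def B_def E_def scalar_proj_def inner_add_right)
  then show ?thesis
    using cond_kurt_indep_add[OF _ _ i, of "\<lambda>z. u \<bullet> z" "\<lambda>z. u \<bullet> z"] c
    by (auto simp: cond_centered_inner cond_weighted_kurt_def add.commute cond_centered_def[of M G]
        elim!: eventually_mono)
qed

section \<open>The stabilized regime\<close>

lemma recovery_gain_bounds:
  assumes "recovery_gain M F K" "1 \<le> t"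
  shows "AE \<omega> in M. 0 \<le> K t \<omega> \<and> K t \<omega> < 1"
proof -
  from assms obtain Kmax where "Kmax < 1" and "AE \<omega> in M. 0 \<le> K t \<omega> \<and> K t \<omega> \<le> Kmax"
    unfolding recovery_gain_def by blast
  from this(2) show ?thesis
    by eventually_elim (use \<open>Kmax < 1\<close> in auto)
qed

text \<open>The predictable gain factors out and variance is additive over the independent disturbance and floor; the
  floor enters as a constant, since its covariance is constant in the window.\<close>

lemma stabilized_step_trace:
  assumes prob: "prob_space M" and sub: "\<And>t. subalgebra M (F t)" and window: "window M W"
    and model: "regime_model M F (Stabilized l \<zeta> \<nu> K)"
    and floor: "AE p in window_law M W. step_cov M F \<nu> (fst p) (snd p) = F\<nu>"
  shows "AE p in window_law M W.
    step_trace M F (innovation (Stabilized l \<zeta> \<nu> K)) (fst p) (snd p) =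
      (1 - K (fst p) (snd p))\<^sup>2 * ((1 - l)\<^sup>2 * step_trace M F \<zeta> (fst p) (snd p) + l\<^sup>2 * trace F\<nu>) \<and>
    0 \<le> trace F\<nu> \<and> 0 \<le> step_trace M F \<zeta> (fst p) (snd p) \<and>
    0 \<le> K (fst p) (snd p) \<and> K (fst p) (snd p) < 1"
proof -
  have XY: "channel M F \<zeta>" "channel M F \<nu>" "channels_cond_indep M F \<zeta> \<nu>" and K: "recovery_gain M F K"
    using model by auto
  have meas: "(\<lambda>\<omega>. 1 - K t \<omega>) \<in> borel_measurable (F (t - 1))" if "1 \<le> t" for t
    using K that by (auto simp: recovery_gain_def)
  have "AE p in window_law M W.
      step_trace M F (innovation (Stabilized l \<zeta> \<nu> K)) (fst p) (snd p) =
      (1 - K (fst p) (snd p))\<^sup>2 *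
        ((1 - l)\<^sup>2 * step_trace M F \<zeta> (fst p) (snd p) + l\<^sup>2 * step_trace M F \<nu> (fst p) (snd p)) \<and>
      0 \<le> step_trace M F \<nu> (fst p) (snd p) \<and> 0 \<le> step_trace M F \<zeta> (fst p) (snd p) \<and>
      0 \<le> K (fst p) (snd p) \<and> K (fst p) (snd p) < 1"
    unfolding innovation.simps residual_def
    by (intro AE_window_law[OF prob window] AE_conjI step_trace_combination[OF prob sub XY]
        step_trace_nonneg[OF prob sub])
       (use meas recovery_gain_bounds[OF K] in auto)
  with floor show ?thesis
    by eventually_elim (auto simp: step_trace_def)
qed

lemma measurable_gain:
  assumes "\<And>t. subalgebra M (F t)" "recovery_gain M F K" "1 \<le> t"
  shows "K t \<in> borel_measurable M"
  using assms measurable_from_subalg unfolding recovery_gain_def by blast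

context
  fixes M :: "'a measure" and F :: "nat \<Rightarrow> 'a measure" and W :: "(nat \<times> 'a) set"
    and l :: real and \<zeta> \<nu> :: "nat \<Rightarrow> 'a \<Rightarrow> real^'n" and K :: "nat \<Rightarrow> 'a \<Rightarrow> real" and F\<nu> :: "real^'n^'n"
  assumes prob: "prob_space M" and sub: "\<And>t. subalgebra M (F t)" and window: "window M W"
    and model: "regime_model M F (Stabilized l \<zeta> \<nu> K)"
    and floor: "AE p in window_law M W. step_cov M F \<nu> (fst p) (snd p) = F\<nu>"
    and fin: "window_integrable M W (step_trace M F \<zeta>)"
begin

lemma residual_window_avg:
  "window_integrable M W (\<lambda>t \<omega>. (1 - l)\<^sup>2 * step_trace M F \<zeta> t \<omega> + l\<^sup>2 * trace F\<nu>)"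
  "window_avg M W (\<lambda>t \<omega>. (1 - l)\<^sup>2 * step_trace M F \<zeta> t \<omega> + l\<^sup>2 * trace F\<nu>) =
    (1 - l)\<^sup>2 * window_avg M W (step_trace M F \<zeta>) + l\<^sup>2 * trace F\<nu>"
proof -
  interpret Q: prob_space "window_law M W" by (rule prob_space_window_law[OF window])
  show "window_integrable M W (\<lambda>t \<omega>. (1 - l)\<^sup>2 * step_trace M F \<zeta> t \<omega> + l\<^sup>2 * trace F\<nu>)"
    "window_avg M W (\<lambda>t \<omega>. (1 - l)\<^sup>2 * step_trace M F \<zeta> t \<omega> + l\<^sup>2 * trace F\<nu>) =
      (1 - l)\<^sup>2 * window_avg M W (step_trace M F \<zeta>) + l\<^sup>2 * trace F\<nu>"
    using fin by (simp_all add: window_integrable_def window_avg_def Q.prob_space)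
qed

lemma stabilized_step_trace_le:
  "AE p in window_law M W.
    0 \<le> step_trace M F (innovation (Stabilized l \<zeta> \<nu> K)) (fst p) (snd p) \<and>
    step_trace M F (innovation (Stabilized l \<zeta> \<nu> K)) (fst p) (snd p) \<le>
      (1 - l)\<^sup>2 * step_trace M F \<zeta> (fst p) (snd p) + l\<^sup>2 * trace F\<nu>"
  using stabilized_step_trace[OF prob sub window model floor]
proof eventually_elim
  case (elim p)
  let ?H = "(1 - l)\<^sup>2 * step_trace M F \<zeta> (fst p) (snd p) + l\<^sup>2 * trace F\<nu>"
  have "0 \<le> ?H" using elim by simp
  moreover have "(1 - K (fst p) (snd p))\<^sup>2 \<le> 1" using elim by (simp add: power_le_one)
  ultimately have "(1 - K (fst p) (snd p))\<^sup>2 * ?H \<le> 1 * ?H" by (intro mult_right_mono)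
  with elim \<open>0 \<le> ?H\<close> show ?case by simp
qed

lemma stabilized_window_integrable:
  "window_integrable M W (step_trace M F (innovation (Stabilized l \<zeta> \<nu> K)))"
  unfolding window_integrable_def
proof (rule Bochner_Integration.integrable_bound[OF residual_window_avg(1)[unfolded window_integrable_def]])
  show "AE p in window_law M W. norm (step_trace M F (innovation (Stabilized l \<zeta> \<nu> K)) (fst p) (snd p)) \<le>
      norm ((1 - l)\<^sup>2 * step_trace M F \<zeta> (fst p) (snd p) + l\<^sup>2 * trace F\<nu>)"
    using stabilized_step_trace_le by eventually_elim simp
qed (intro measurable_window_law borel_measurable_step_trace)

text \<open>Correction multiplies the trace by \<open>(1 - K\<^sub>t)\<^sup>2 \<le> 1\<close>; the bound is the average for zero gain.\<close>

lemma stabilized_window_avg_le: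
  "window_avg M W (step_trace M F (innovation (Stabilized l \<zeta> \<nu> K))) \<le>
    (1 - l)\<^sup>2 * window_avg M W (step_trace M F \<zeta>) + l\<^sup>2 * trace F\<nu>"
  unfolding residual_window_avg(2)[symmetric]
  unfolding window_avg_def
  using stabilized_step_trace_le stabilized_window_integrable residual_window_avg(1)
  by (intro integral_mono_AE) (auto simp: window_integrable_def simp del: innovation.simps elim!: eventually_mono)

lemma stabilized_window_avg_constant_gain:
  assumes "AE p in window_law M W. K (fst p) (snd p) = k"
  shows "window_avg M W (step_trace M F (innovation (Stabilized l \<zeta> \<nu> K))) =
    (1 - k)\<^sup>2 * ((1 - l)\<^sup>2 * window_avg M W (step_trace M F \<zeta>) + l\<^sup>2 * trace F\<nu>)"
proof -
  have "window_avg M W (step_trace M F (innovation (Stabilized l \<zeta> \<nu> K))) =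
      window_avg M W (\<lambda>t \<omega>. (1 - k)\<^sup>2 * ((1 - l)\<^sup>2 * step_trace M F \<zeta> t \<omega> + l\<^sup>2 * trace F\<nu>))"
  proof (rule window_avg_cong)
    have [measurable]: "step_trace M F \<zeta> t \<in> borel_measurable M" for t
      by (rule borel_measurable_step_trace)
    show "(\<lambda>\<omega>. (1 - k)\<^sup>2 * ((1 - l)\<^sup>2 * step_trace M F \<zeta> t \<omega> + l\<^sup>2 * trace F\<nu>)) \<in> borel_measurable M" for t
      by measurable
    show "AE p in window_law M W. step_trace M F (innovation (Stabilized l \<zeta> \<nu> K)) (fst p) (snd p) =
        (1 - k)\<^sup>2 * ((1 - l)\<^sup>2 * step_trace M F \<zeta> (fst p) (snd p) + l\<^sup>2 * trace F\<nu>)"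
      using stabilized_step_trace[OF prob sub window model floor] assms by eventually_elim simp
  qed (rule borel_measurable_step_trace)
  then show ?thesis
    unfolding residual_window_avg(2)[symmetric] by (simp add: window_avg_def)
qed

text \<open>Without a floor the gain is the only source of reduction, so the expression in the strictness criterion is
  the gap between the two averages.\<close>

lemma floorless_window_avg_deficit:
  assumes "l = 0"
  shows "window_avg M W (\<lambda>t \<omega>. (1 - (1 - K t \<omega>)\<^sup>2) * step_trace M F \<zeta> t \<omega>) =
    window_avg M W (step_trace M F \<zeta>) - window_avg M W (step_trace M F (innovation (Stabilized l \<zeta> \<nu> K)))"
proof -
  let ?H = "step_trace M F (innovation (Stabilized l \<zeta> \<nu> K))"
  have m: "step_trace M F X t \<in> borel_measurable M" for X :: "nat \<Rightarrow> 'a \<Rightarrow> real^'n" and t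
    by (rule borel_measurable_step_trace)
  have "recovery_gain M F K" using model by simp
  note mK = measurable_gain[OF sub this]
  have "window_avg M W (\<lambda>t \<omega>. (1 - (1 - K t \<omega>)\<^sup>2) * step_trace M F \<zeta> t \<omega>) =
      window_avg M W (\<lambda>t \<omega>. step_trace M F \<zeta> t \<omega> - ?H t \<omega>)"
  proof (rule window_avg_cong)
    show "AE p in window_law M W. (1 - (1 - K (fst p) (snd p))\<^sup>2) * step_trace M F \<zeta> (fst p) (snd p) =
        step_trace M F \<zeta> (fst p) (snd p) - ?H (fst p) (snd p)"
      using stabilized_step_trace[OF prob sub window model floor]
      by eventually_elim (simp add: assms algebra_simps)
  next
    fix t :: nat assume "1 \<le> t"
    note [measurable] = mK[OF this] m
    show "(\<lambda>\<omega>. (1 - (1 - K t \<omega>)\<^sup>2) * step_trace M F \<zeta> t \<omega>) \<in> borel_measurable M" by measurable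
    show "(\<lambda>\<omega>. step_trace M F \<zeta> t \<omega> - ?H t \<omega>) \<in> borel_measurable M" by measurable
  qed
  then show ?thesis
    using stabilized_window_integrable fin by (simp add: window_avg_def window_integrable_def del: innovation.simps)
qed

end

text \<open>The residual is a sum of two scaled independent variables. Scaling changes their shares of the variance but
  not their shapes.\<close>

lemma (in prob_space) kurt_residual_law:
  assumes "indep_centered M Z N" "0 < l" "l < 1"
  defines "w \<equiv> (1 - l)\<^sup>2 * law_var M Z / ((1 - l)\<^sup>2 * law_var M Z + l\<^sup>2 * law_var M N)"
  shows "0 < w" "w < 1"
    and "kurt M (\<lambda>p. (1 - l) * Z p + l * N p) = w\<^sup>2 * kurt M Z + (1 - w)\<^sup>2 * kurt M N"
proof -
  have ind: "indep_centered M (\<lambda>p. (1 - l) * Z p) (\<lambda>p. l * N p)"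
    using assms by (intro indep_centered_scale) auto
  note sum = kurt_indep_add[OF ind]
  have w: "share M (\<lambda>p. (1 - l) * Z p) (\<lambda>p. l * N p) = w"
    using sum(1) by (simp add: share_def w_def law_var_scale)
  with sum have v: "share M (\<lambda>p. l * N p) (\<lambda>p. (1 - l) * Z p) = 1 - w" by simp
  from sum w v show "0 < w" "w < 1" by auto
  show "kurt M (\<lambda>p. (1 - l) * Z p + l * N p) = w\<^sup>2 * kurt M Z + (1 - w)\<^sup>2 * kurt M N"
    using assms(2,3) by (simp add: sum(5) weighted_kurt_def w v kurt_scale)
qed

lemma (in sigma_finite_subalgebra) cond_kurt_residual:
  fixes X Y :: "'a \<Rightarrow> real^'n" and u :: "real^'n"
  assumes c: "cond_centered M F X" "cond_centered M F Y" and indep: "cond_indep M F X Y"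
    and l: "0 < l" "l < 1"
  defines "Z \<equiv> \<lambda>x. u \<bullet> X x" and "N \<equiv> \<lambda>x. u \<bullet> Y x"
  defines "w \<equiv> \<lambda>\<omega>. (1 - l)\<^sup>2 * cond_var M F Z \<omega> / ((1 - l)\<^sup>2 * cond_var M F Z \<omega> + l\<^sup>2 * cond_var M F N \<omega>)"
  shows "AE \<omega> in M. cond_kurt_defined M F Z \<omega> \<and> cond_kurt_defined M F N \<omega> \<longrightarrow>
    0 < w \<omega> \<and> w \<omega> < 1 \<and>
    cond_kurt M F (\<lambda>x. (1 - l) * Z x + l * N x) \<omega> =
      (w \<omega>)\<^sup>2 * cond_kurt M F Z \<omega> + (1 - w \<omega>)\<^sup>2 * cond_kurt M F N \<omega>"
proof -
  have m[measurable]: "X \<in> borel_measurable M" "Y \<in> borel_measurable M"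
    using c by (auto simp: cond_centered_def)
  then have ZN[measurable]: "Z \<in> borel_measurable M" "N \<in> borel_measurable M"
    by (auto simp: Z_def N_def)
  have cc: "cond_centered_real M F (\<lambda>x. (1 - l) * (u \<bullet> X x))" "cond_centered_real M F (\<lambda>x. l * (u \<bullet> Y x))"
    by (auto intro!: cond_centered_real_measurable_mult cond_centered_inner c)
  have scaled: "AE \<omega> in M. cond_var M F (\<lambda>x. r * V x) \<omega> = r\<^sup>2 * cond_var M F V \<omega> \<and>
      cond_kurt M F (\<lambda>x. r * V x) \<omega> = cond_kurt M F V \<omega> \<and>
      (cond_kurt_defined M F V \<omega> \<longrightarrow> cond_kurt_defined M F (\<lambda>x. r * V x) \<omega>)"
    if "V \<in> borel_measurable M" "r \<noteq> 0" for V and r :: real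
    using that by (intro AE_conjI cond_var_scale cond_kurt_scale cond_kurt_defined_scale) auto
  have r: "1 - l \<noteq> 0" "l \<noteq> 0" using l by auto
  have "AE \<omega> in M. cond_kurt_defined M F (\<lambda>x. (1 - l) * Z x) \<omega> \<and> cond_kurt_defined M F (\<lambda>x. l * N x) \<omega> \<longrightarrow>
      cond_var M F (\<lambda>x. (1 - l) * Z x + l * N x) \<omega> =
        cond_var M F (\<lambda>x. (1 - l) * Z x) \<omega> + cond_var M F (\<lambda>x. l * N x) \<omega> \<and>
      0 < cond_share M F (\<lambda>x. (1 - l) * Z x) (\<lambda>x. l * N x) \<omega> \<and>
      0 < cond_share M F (\<lambda>x. l * N x) (\<lambda>x. (1 - l) * Z x) \<omega> \<and>
      cond_share M F (\<lambda>x. (1 - l) * Z x) (\<lambda>x. l * N x) \<omega> +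
        cond_share M F (\<lambda>x. l * N x) (\<lambda>x. (1 - l) * Z x) \<omega> = 1 \<and>
      cond_kurt M F (\<lambda>x. (1 - l) * Z x + l * N x) \<omega> =
        cond_weighted_kurt M F (\<lambda>x. (1 - l) * Z x) (\<lambda>x. l * N x) \<omega>"
    unfolding Z_def N_def by (rule cond_kurt_indep_add[OF m indep _ _ cc]) measurable
  with scaled[OF ZN(1) r(1)] scaled[OF ZN(2) r(2)]
  show ?thesis
  proof eventually_elim
    case (elim \<omega>)
    show ?case
    proof (intro impI)
      assume "cond_kurt_defined M F Z \<omega> \<and> cond_kurt_defined M F N \<omega>"
      note sum = elim(3)[rule_format, OF conjI, OF elim(1)[THEN conjunct2, THEN conjunct2, rule_format]
          elim(2)[THEN conjunct2, THEN conjunct2, rule_format], OF conjunct1[OF this] conjunct2[OF this]]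
      then have 1: "cond_share M F (\<lambda>x. (1 - l) * Z x) (\<lambda>x. l * N x) \<omega> = w \<omega>"
        using elim(1,2) by (simp add: cond_share_def w_def)
      with sum have 2: "cond_share M F (\<lambda>x. l * N x) (\<lambda>x. (1 - l) * Z x) \<omega> = 1 - w \<omega>" by simp
      from sum elim(1,2) 1 2 show "0 < w \<omega> \<and> w \<omega> < 1 \<and>
          cond_kurt M F (\<lambda>x. (1 - l) * Z x + l * N x) \<omega> =
          (w \<omega>)\<^sup>2 * cond_kurt M F Z \<omega> + (1 - w \<omega>)\<^sup>2 * cond_kurt M F N \<omega>"
        by (simp add: cond_weighted_kurt_def)
    qed
  qed
qed

text \<open>The gain is predictable and below 1, so given the history it is a nonzero constant factor.\<close>

lemma step_kurt_stabilized:
  assumes prob: "prob_space M" and sub: "\<And>t. subalgebra M (F t)"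
    and model: "regime_model M F (Stabilized l \<zeta> \<nu> K)" and "1 \<le> t"
  shows "AE \<omega> in M. cond_kurt M (F (t - 1)) (scalar_proj u (innovation (Stabilized l \<zeta> \<nu> K)) t) \<omega> =
    cond_kurt M (F (t - 1)) (\<lambda>x. (1 - l) * scalar_proj u \<zeta> t x + l * scalar_proj u \<nu> t x) \<omega>"
proof -
  interpret sigma_finite_subalgebra M "F (t - 1)"
    by (rule sigma_finite_subalgebra_of_prob_space[OF prob sub])
  have [measurable]: "\<zeta> t \<in> borel_measurable M" "\<nu> t \<in> borel_measurable M"
    using model \<open>1 \<le> t\<close> by (auto simp: channel_def cond_centered_def)
  have "AE \<omega> in M. cond_kurt M (F (t - 1))
        (\<lambda>x. (1 - K t x) * ((1 - l) * scalar_proj u \<zeta> t x + l * scalar_proj u \<nu> t x)) \<omega> =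
      cond_kurt M (F (t - 1)) (\<lambda>x. (1 - l) * scalar_proj u \<zeta> t x + l * scalar_proj u \<nu> t x) \<omega>"
  proof (rule cond_kurt_scale)
    show "(\<lambda>x. 1 - K t x) \<in> borel_measurable (F (t - 1))"
      using model \<open>1 \<le> t\<close> by (auto simp: recovery_gain_def)
    have "recovery_gain M F K" using model by simp
    from recovery_gain_bounds[OF this \<open>1 \<le> t\<close>] show "AE \<omega> in M. 1 - K t \<omega> \<noteq> 0"
      by eventually_elim simp
    show "(\<lambda>x. (1 - l) * scalar_proj u \<zeta> t x + l * scalar_proj u \<nu> t x) \<in> borel_measurable M"
      unfolding scalar_proj_def by measurable
  qed
  moreover have "scalar_proj u (innovation (Stabilized l \<zeta> \<nu> K)) t =
      (\<lambda>x. (1 - K t x) * ((1 - l) * scalar_proj u \<zeta> t x + l * scalar_proj u \<nu> t x))"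
    by (simp add: fun_eq_iff scalar_proj_def residual_def inner_simps)
  ultimately show ?thesis by simp
qed


theorem proposition2:
  fixes M :: "'a measure" and F :: "nat \<Rightarrow> 'a measure"
    and event quiet :: "(nat \<times> 'a) set"
    and \<zeta>I \<zeta>e \<zeta>b \<zeta> \<nu> :: "nat \<Rightarrow> 'a \<Rightarrow> real^'n"
    and l :: real and K :: "nat \<Rightarrow> 'a \<Rightarrow> real" and F\<nu> :: "real^'n^'n"
  assumes prob: "prob_space M"
    and filtr: "filtration (space M) F" "\<And>t. subalgebra M (F t)"
    and windows: "window M event" "window M quiet"
  shows
    \<comment> \<open>(i)\<close>
    "(\<forall>R :: ('a, 'n) regime.
        uncorrected R \<and> regime_model M F R \<and> forcing_rises M F event quiet R \<longrightarrow>
        innovation R = twin_innovation R \<and>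
        dH M F event quiet R = dV M F event quiet R \<and> dH M F event quiet R > 0 \<and>
        (\<forall>u. kurt_increment M event quiet u (innovation R) =
               kurt_increment M event quiet u (twin_innovation R) \<and>
             avg_cond_kurt_increment M F event quiet u (innovation R) =
               avg_cond_kurt_increment M F event quiet u (twin_innovation R)))
   \<and> \<comment> \<open>(ii), law of a conditioning set\<close>
     (regime_model M F (Forced \<zeta>e \<zeta>b) \<longrightarrow>
       (\<forall>W u. window M W \<and>
          indep_centered (window_law M W) (pooled_proj u \<zeta>b) (pooled_proj u \<zeta>e) \<longrightarrow>
          (let Q = window_law M W; B = pooled_proj u \<zeta>b; E = pooled_proj u \<zeta>e;
               X = pooled_proj u (innovation (Forced \<zeta>e \<zeta>b)); I = pooled_proj u \<zeta>I in
             share Q B E + share Q E B = 1 \<and>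
             kurt Q X = (share Q B E)\<^sup>2 * kurt Q B + (share Q E B)\<^sup>2 * kurt Q E \<and>
             (regime_model M F (Inert \<zeta>I) \<and> kurt_defined Q I \<and> same_std_law Q E I \<longrightarrow>
                kurt Q E = kurt Q I \<and>
                (kurt Q I \<ge> 0 \<and> kurt Q B \<le> kurt Q I \<longrightarrow> kurt Q X \<le> kurt Q I)))) \<and>
       (\<forall>u. indep_centered (window_law M event) (pooled_proj u \<zeta>b) (pooled_proj u \<zeta>e) \<and>
            indep_centered (window_law M quiet) (pooled_proj u \<zeta>b) (pooled_proj u \<zeta>e) \<longrightarrow>
          (kurt_increment M event quiet u (innovation (Forced \<zeta>e \<zeta>b)) > 0 \<longleftrightarrow>
           weighted_kurt (window_law M event) (pooled_proj u \<zeta>b) (pooled_proj u \<zeta>e) >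
           weighted_kurt (window_law M quiet) (pooled_proj u \<zeta>b) (pooled_proj u \<zeta>e))))
   \<and> \<comment> \<open>(ii), conditional histories and averages over them\<close>
     (regime_model M F (Forced \<zeta>e \<zeta>b) \<and> channels_cond_indep M F \<zeta>e \<zeta>b \<longrightarrow>
       (\<forall>t\<ge>1. \<forall>u. AE \<omega> in M.
          (let G = F (t - 1); B = scalar_proj u \<zeta>b t; E = scalar_proj u \<zeta>e t;
               X = scalar_proj u (innovation (Forced \<zeta>e \<zeta>b)) t in
             cond_kurt_defined M G B \<omega> \<and> cond_kurt_defined M G E \<omega> \<longrightarrow>
             cond_share M G B E \<omega> + cond_share M G E B \<omega> = 1 \<and>
             cond_kurt M G X \<omega> = (cond_share M G B E \<omega>)\<^sup>2 * cond_kurt M G B \<omega>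
                                  + (cond_share M G E B \<omega>)\<^sup>2 * cond_kurt M G E \<omega>)) \<and>
       (\<forall>t\<ge>1. \<forall>u. \<forall>A \<in> sets (F (t - 1)).
          regime_model M F (Inert \<zeta>I) \<and>
          cond_same_std_law M (F (t - 1)) A (scalar_proj u \<zeta>e t) (scalar_proj u \<zeta>I t) \<longrightarrow>
          (AE \<omega> in M.
            (let G = F (t - 1); B = scalar_proj u \<zeta>b t; E = scalar_proj u \<zeta>e t;
                 X = scalar_proj u (innovation (Forced \<zeta>e \<zeta>b)) t; I = scalar_proj u \<zeta>I t in
               \<omega> \<in> A \<and> cond_kurt_defined M G B \<omega> \<and> cond_kurt_defined M G E \<omega> \<and>
               cond_kurt_defined M G I \<omega> \<longrightarrow>
               cond_kurt M G E \<omega> = cond_kurt M G I \<omega> \<and>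
               (cond_kurt M G I \<omega> \<ge> 0 \<and> cond_kurt M G B \<omega> \<le> cond_kurt M G I \<omega> \<longrightarrow>
                  cond_kurt M G X \<omega> \<le> cond_kurt M G I \<omega>)))) \<and>
       (\<forall>u. let D = (\<lambda>p. cond_kurt_defined M (F (fst p - 1)) (scalar_proj u \<zeta>b (fst p)) (snd p) \<and>
                         cond_kurt_defined M (F (fst p - 1)) (scalar_proj u \<zeta>e (fst p)) (snd p));
                k = step_kurt M F u (innovation (Forced \<zeta>e \<zeta>b));
                wk = (\<lambda>t. cond_weighted_kurt M (F (t - 1)) (scalar_proj u \<zeta>b t) (scalar_proj u \<zeta>e t)) in
            (AE p in window_law M event. D p) \<and> (AE p in window_law M quiet. D p) \<longrightarrow>
            window_avg M event k = window_avg M event wk \<and>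
            window_avg M quiet k = window_avg M quiet wk \<and>
            (avg_cond_kurt_increment M F event quiet u (innovation (Forced \<zeta>e \<zeta>b)) > 0 \<longleftrightarrow>
             window_avg M event wk > window_avg M quiet wk)))
   \<and> \<comment> \<open>(iii), variance\<close>
     (regime_model M F (Stabilized l \<zeta> \<nu> K) \<and>
      forcing_rises M F event quiet (Stabilized l \<zeta> \<nu> K) \<and>
      (AE p in window_law M event. step_cov M F \<nu> (fst p) (snd p) = F\<nu>) \<and>
      (AE p in window_law M quiet. step_cov M F \<nu> (fst p) (snd p) = F\<nu>) \<and>
      pos_definite (window_cov M F quiet (residual l \<zeta> \<nu>)) \<longrightarrow>
       (let \<Delta>H = dH M F event quiet (Stabilized l \<zeta> \<nu> K);
            \<Delta>V = dV M F event quiet (Stabilized l \<zeta> \<nu> K);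
            V = step_trace M F (twin_innovation (Stabilized l \<zeta> \<nu> K)) in
          ((AE p in window_law M quiet. K (fst p) (snd p) = 0) \<longrightarrow>
             (l > 0 \<longrightarrow> \<Delta>H \<le> (1 - l)\<^sup>2 * \<Delta>V \<and> (1 - l)\<^sup>2 * \<Delta>V < \<Delta>V) \<and>
             (l = 0 \<longrightarrow>
                (\<Delta>H < \<Delta>V \<longleftrightarrow>
                 window_avg M event (\<lambda>t \<omega>. (1 - (1 - K t \<omega>)\<^sup>2) * V t \<omega>) > 0))) \<and>
          (\<forall>k. 0 \<le> k \<and> k < 1 \<and>
               (AE p in window_law M event. K (fst p) (snd p) = k) \<and>
               (AE p in window_law M quiet. K (fst p) (snd p) = k) \<longrightarrow>
             \<Delta>H = (1 - k)\<^sup>2 * (1 - l)\<^sup>2 * \<Delta>V \<and> (k > 0 \<or> l > 0 \<longrightarrow> \<Delta>H < \<Delta>V))))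
   \<and> \<comment> \<open>(iii), shape under a window law and at a conditional history\<close>
     (regime_model M F (Stabilized l \<zeta> \<nu> K) \<longrightarrow>
       (\<forall>W u. window M W \<and>
          indep_centered (window_law M W) (pooled_proj u \<zeta>) (pooled_proj u \<nu>) \<longrightarrow>
          (let Q = window_law M W; Z = pooled_proj u \<zeta>; N = pooled_proj u \<nu>;
               R = (\<lambda>p. (1 - l) * Z p + l * N p);
               w = (1 - l)\<^sup>2 * law_var Q Z / ((1 - l)\<^sup>2 * law_var Q Z + l\<^sup>2 * law_var Q N) in
             (kurt Q Z > 0 \<and> kurt Q N = 0 \<and> 0 < l \<and> l < 1 \<longrightarrow>
                0 < kurt Q R \<and> kurt Q R = w\<^sup>2 * kurt Q Z \<and> w\<^sup>2 * kurt Q Z < kurt Q Z) \<and>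
             (l = 0 \<longrightarrow> kurt Q R = kurt Q Z) \<and> (l = 1 \<longrightarrow> kurt Q R = kurt Q N))) \<and>
       (\<forall>t\<ge>1. \<forall>u. AE \<omega> in M.
          (let G = F (t - 1); Z = scalar_proj u \<zeta> t; N = scalar_proj u \<nu> t;
               R = (\<lambda>x. (1 - l) * Z x + l * N x);
               X = scalar_proj u (innovation (Stabilized l \<zeta> \<nu> K)) t;
               w = (1 - l)\<^sup>2 * cond_var M G Z \<omega>
                   / ((1 - l)\<^sup>2 * cond_var M G Z \<omega> + l\<^sup>2 * cond_var M G N \<omega>) in
             cond_kurt_defined M G Z \<omega> \<and> cond_kurt_defined M G N \<omega> \<longrightarrow>
             (cond_kurt M G Z \<omega> > 0 \<and> cond_kurt M G N \<omega> = 0 \<and> 0 < l \<and> l < 1 \<longrightarrow>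
                0 < cond_kurt M G R \<omega> \<and> cond_kurt M G R \<omega> = w\<^sup>2 * cond_kurt M G Z \<omega> \<and>
                w\<^sup>2 * cond_kurt M G Z \<omega> < cond_kurt M G Z \<omega> \<and>
                0 < cond_kurt M G X \<omega> \<and> cond_kurt M G X \<omega> < cond_kurt M G Z \<omega>) \<and>
             cond_kurt M G X \<omega> = cond_kurt M G R \<omega> \<and>
             (l = 0 \<longrightarrow> cond_kurt M G R \<omega> = cond_kurt M G Z \<omega>) \<and>
             (l = 1 \<longrightarrow> cond_kurt M G R \<omega> = cond_kurt M G N \<omega>))))"
proof (intro conjI, goal_cases)
  case 1
  show ?case
  proof (intro allI impI, goal_cases)
    case (1 R)
    then have twin: "innovation R = twin_innovation R" by (cases R) auto
    have "dH M F event quiet R > 0"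
    proof (cases R)
      case (Inert \<zeta>e)
      with 1 show ?thesis by (simp add: dH_def dV_def)
    next
      case (Forced \<zeta>e \<zeta>b)
      with 1 have "trace_increment M F event quiet (\<lambda>t \<omega>. \<zeta>e t \<omega> + \<zeta>b t \<omega>) =
          trace_increment M F event quiet \<zeta>e + trace_increment M F event quiet \<zeta>b"
        by (intro trace_increment_add[OF prob filtr(2) windows]) auto
      with 1 Forced show ?thesis by (simp add: dH_def)
    qed (use 1 in simp)
    with twin show ?case
      by (simp add: dH_def dV_def)
  qed
next
  case 2
  show ?case
  proof (intro impI conjI allI, goal_cases)
    case (1 W u)
    let ?Q = "window_law M W" and ?B = "pooled_proj u \<zeta>b" and ?E = "pooled_proj u \<zeta>e"
    let ?X = "pooled_proj u (innovation (Forced \<zeta>e \<zeta>b))" and ?I = "pooled_proj u \<zeta>I"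
    from 1 have W: "window M W" and ind: "indep_centered ?Q ?B ?E" by auto
    interpret Q: prob_space ?Q by (rule prob_space_window_law[OF W])
    note share = Q.kurt_indep_add(2-4)[OF ind]
    have kX: "kurt ?Q ?X = (share ?Q ?B ?E)\<^sup>2 * kurt ?Q ?B + (share ?Q ?E ?B)\<^sup>2 * kurt ?Q ?E"
      using pooled_kurt_forced[OF W ind] by (simp only: weighted_kurt_def)
    have kE: "kurt ?Q ?E = kurt ?Q ?I" if "kurt_defined ?Q ?I" "same_std_law ?Q ?E ?I"
      using that ind by (intro Q.kurt_same_std_law) (auto simp: kurt_defined_def indep_centered_def)
    have "kurt ?Q ?X \<le> kurt ?Q ?I"
      if "kurt ?Q ?E = kurt ?Q ?I" "0 \<le> kurt ?Q ?I" "kurt ?Q ?B \<le> kurt ?Q ?I"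
      unfolding kX that(1) using share that by (intro weighted_sum_le) auto
    with share kX kE show ?case unfolding Let_def by blast
  next
    case (2 u)
    then show ?case
      using pooled_kurt_forced[OF windows(1), of u \<zeta>b \<zeta>e] pooled_kurt_forced[OF windows(2), of u \<zeta>b \<zeta>e]
      by (simp add: kurt_increment_def del: innovation.simps)
  qed
next
  case 3
  show ?case
  proof (intro impI conjI allI ballI, goal_cases)
    case (1 t u)
    note kurt_sum = step_kurt_forced[OF prob filtr(2) conjunct1[OF 1(1)] conjunct2[OF 1(1)] 1(2)]
    from kurt_sum[of u] show ?case
      unfolding Let_def cond_weighted_kurt_def by eventually_elim blast
  next
    case (2 t u A)
    then have model: "regime_model M F (Forced \<zeta>e \<zeta>b)" and indep: "channels_cond_indep M F \<zeta>e \<zeta>b"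
      and inert: "regime_model M F (Inert \<zeta>I)" and t: "1 \<le> t"
      and same: "cond_same_std_law M (F (t - 1)) A (scalar_proj u \<zeta>e t) (scalar_proj u \<zeta>I t)"
      by blast+
    interpret sigma_finite_subalgebra M "F (t - 1)"
      by (rule sigma_finite_subalgebra_of_prob_space[OF prob filtr(2)])
    have "scalar_proj u \<zeta>e t \<in> borel_measurable M" "scalar_proj u \<zeta>I t \<in> borel_measurable M"
      using model inert t by (auto simp: scalar_proj_def[abs_def] channel_def cond_centered_def)
    from step_kurt_forced[OF prob filtr(2) model indep t, of u] cond_kurt_same_std_law[OF this same]
    show ?case
      unfolding Let_def cond_weighted_kurt_def
      by eventually_elim (simp add: weighted_sum_le less_imp_le del: innovation.simps)
  next
    case (3 u)
    note kurt_sum = step_kurt_forced[OF prob filtr(2) conjunct1[OF 3] conjunct2[OF 3], of _ u]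
    let ?D = "\<lambda>t \<omega>. cond_kurt_defined M (F (t - 1)) (scalar_proj u \<zeta>b t) \<omega> \<and>
        cond_kurt_defined M (F (t - 1)) (scalar_proj u \<zeta>e t) \<omega>"
    let ?k = "step_kurt M F u (innovation (Forced \<zeta>e \<zeta>b))"
    let ?wk = "\<lambda>t. cond_weighted_kurt M (F (t - 1)) (scalar_proj u \<zeta>b t) (scalar_proj u \<zeta>e t)"
    have "window_avg M W ?k = window_avg M W ?wk"
      if W: "window M W" and D: "AE p in window_law M W. ?D (fst p) (snd p)" for W
    proof (rule window_avg_cong)
      show "?k t \<in> borel_measurable M" for t
        unfolding step_kurt_def[abs_def] by (rule borel_measurable_cond_kurt)
      show "?wk t \<in> borel_measurable M" for t
        by (rule borel_measurable_cond_weighted_kurt)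
      have "AE \<omega> in M. ?D t \<omega> \<longrightarrow> ?k t \<omega> = ?wk t \<omega>" if "1 \<le> t" for t
        using kurt_sum[OF that] unfolding step_kurt_def by eventually_elim blast
      then have "AE p in window_law M W. ?D (fst p) (snd p) \<longrightarrow> ?k (fst p) (snd p) = ?wk (fst p) (snd p)"
        by (rule AE_window_law[OF prob W])
      with D show "AE p in window_law M W. ?k (fst p) (snd p) = ?wk (fst p) (snd p)"
        by eventually_elim blast
    qed
    then show ?case
      using windows unfolding Let_def avg_cond_kurt_increment_def by (simp del: innovation.simps)
  qed
next
  case 4
  show ?case
  proof (rule impI, goal_cases)
    case 1
    then have model: "regime_model M F (Stabilized l \<zeta> \<nu> K)"
      and rise: "forcing_rises M F event quiet (Stabilized l \<zeta> \<nu> K)"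
      and floor: "AE p in window_law M event. step_cov M F \<nu> (fst p) (snd p) = F\<nu>"
        "AE p in window_law M quiet. step_cov M F \<nu> (fst p) (snd p) = F\<nu>"
      by blast+
    let ?S = "Stabilized l \<zeta> \<nu> K"
    let ?H = "dH M F event quiet ?S" and ?V = "dV M F event quiet ?S"
    let ?v = "\<lambda>W. window_avg M W (step_trace M F \<zeta>)" and ?h = "\<lambda>W. window_avg M W (step_trace M F (innovation ?S))"
    have l: "0 \<le> l" "l \<le> 1" using model by auto
    have V: "?V = ?v event - ?v quiet" and H: "?H = ?h event - ?h quiet"
      by (simp_all add: dV_def dH_def trace_increment_def del: innovation.simps)
    have pos: "0 < ?V" and fin: "window_integrable M event (step_trace M F \<zeta>)" "window_integrable M quiet (step_trace M F \<zeta>)"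
      using rise by (auto simp: finite_traces_def)
    note e = prob filtr(2) windows(1) model floor(1) fin(1)
    note q = prob filtr(2) windows(2) model floor(2) fin(2)
    have strict: "c * ?V < ?V" if "c < 1" for c
      using mult_strict_right_mono[OF that pos] by simp
    have "(l > 0 \<longrightarrow> ?H \<le> (1 - l)\<^sup>2 * ?V \<and> (1 - l)\<^sup>2 * ?V < ?V) \<and>
        (l = 0 \<longrightarrow> (?H < ?V \<longleftrightarrow>
           window_avg M event (\<lambda>t \<omega>. (1 - (1 - K t \<omega>)\<^sup>2) * step_trace M F \<zeta> t \<omega>) > 0))"
      if "AE p in window_law M quiet. K (fst p) (snd p) = 0"
    proof -
      \<comment> \<open>with zero gain the quiet average attains the bound that the event average merely obeys\<close>
      have quiet: "?h quiet = (1 - l)\<^sup>2 * ?v quiet + l\<^sup>2 * trace F\<nu>"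
        using stabilized_window_avg_constant_gain[OF q that] by (simp del: innovation.simps)
      then have "?H \<le> (1 - l)\<^sup>2 * ?V"
        using stabilized_window_avg_le[OF e] by (simp add: H V right_diff_distrib del: innovation.simps)
      moreover have "(1 - l)\<^sup>2 * ?V < ?V" if "0 < l"
        using that l by (intro strict) (simp add: power_less_one_iff)
      moreover have "?H < ?V \<longleftrightarrow>
           window_avg M event (\<lambda>t \<omega>. (1 - (1 - K t \<omega>)\<^sup>2) * step_trace M F \<zeta> t \<omega>) > 0" if "l = 0"
        unfolding floorless_window_avg_deficit[OF e that] H V quiet by (simp add: that del: innovation.simps)
      ultimately show ?thesis by blast
    qed
    moreover have "?H = (1 - k)\<^sup>2 * (1 - l)\<^sup>2 * ?V \<and> (k > 0 \<or> l > 0 \<longrightarrow> ?H < ?V)"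
      if k: "0 \<le> k" "k < 1" and "AE p in window_law M event. K (fst p) (snd p) = k"
        "AE p in window_law M quiet. K (fst p) (snd p) = k" for k
    proof -
      have eq: "?H = (1 - k)\<^sup>2 * (1 - l)\<^sup>2 * ?V"
        unfolding H V stabilized_window_avg_constant_gain[OF e that(3)]
          stabilized_window_avg_constant_gain[OF q that(4)]
        by (simp add: algebra_simps)
      have "(1 - k)\<^sup>2 * (1 - l)\<^sup>2 < 1" if "k > 0 \<or> l > 0"
      proof -
        have "(1 - k) * (1 - l) < 1"
          using that
        proof
          assume "k > 0"
          have "(1 - k) * (1 - l) \<le> 1 - k" using k l by (intro mult_left_le) auto
          also have "1 - k < 1" using \<open>k > 0\<close> by simp
          finally show ?thesis .
        next
          assume "l > 0"
          have "(1 - k) * (1 - l) \<le> 1 - l" using k l by (intro mult_left_le_one_le) auto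
          also have "1 - l < 1" using \<open>l > 0\<close> by simp
          finally show ?thesis .
        qed
        moreover have "0 \<le> (1 - k) * (1 - l)" using k l by simp
        ultimately show ?thesis by (simp add: power_less_one_iff flip: power_mult_distrib)
      qed
      with eq strict show ?thesis by simp
    qed
    ultimately show ?case
      unfolding Let_def twin_innovation.simps by blast
  qed
next
  case 5
  show ?case
  proof (intro impI conjI allI, goal_cases)
    case (1 W u)
    let ?Q = "window_law M W" and ?Z = "pooled_proj u \<zeta>" and ?N = "pooled_proj u \<nu>"
    from 1 have W: "window M W" and ind: "indep_centered ?Q ?Z ?N" by auto
    interpret Q: prob_space ?Q by (rule prob_space_window_law[OF W])
    note mixed = dilution_strict[OF Q.kurt_residual_law[OF ind]]
    show ?case
      unfolding Let_def by (intro conjI impI) (blast dest: mixed | simp)+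
  next
    case (2 t u)
    interpret sigma_finite_subalgebra M "F (t - 1)"
      by (rule sigma_finite_subalgebra_of_prob_space[OF prob filtr(2)])
    have c: "cond_centered M (F (t - 1)) (\<zeta> t)" "cond_centered M (F (t - 1)) (\<nu> t)"
        "cond_indep M (F (t - 1)) (\<zeta> t) (\<nu> t)"
      using 2 by (auto simp: channel_def channels_cond_indep_def)
    have X: "AE \<omega> in M. cond_kurt M (F (t - 1)) (scalar_proj u (innovation (Stabilized l \<zeta> \<nu> K)) t) \<omega> =
        cond_kurt M (F (t - 1)) (\<lambda>x. (1 - l) * scalar_proj u \<zeta> t x + l * scalar_proj u \<nu> t x) \<omega>"
      by (rule step_kurt_stabilized[OF prob filtr(2)]) (use 2 in auto)
    show ?case
    proof (cases "0 < l \<and> l < 1")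
      case True
      with cond_kurt_residual[OF c, of l u] have "AE \<omega> in M.
          cond_kurt_defined M (F (t - 1)) (scalar_proj u \<zeta> t) \<omega> \<and>
          cond_kurt_defined M (F (t - 1)) (scalar_proj u \<nu> t) \<omega> \<longrightarrow>
          (let w = (1 - l)\<^sup>2 * cond_var M (F (t - 1)) (scalar_proj u \<zeta> t) \<omega> /
            ((1 - l)\<^sup>2 * cond_var M (F (t - 1)) (scalar_proj u \<zeta> t) \<omega> +
             l\<^sup>2 * cond_var M (F (t - 1)) (scalar_proj u \<nu> t) \<omega>) in
           0 < w \<and> w < 1 \<and>
           cond_kurt M (F (t - 1)) (\<lambda>x. (1 - l) * scalar_proj u \<zeta> t x + l * scalar_proj u \<nu> t x) \<omega> =
           w\<^sup>2 * cond_kurt M (F (t - 1)) (scalar_proj u \<zeta> t) \<omega> +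
           (1 - w)\<^sup>2 * cond_kurt M (F (t - 1)) (scalar_proj u \<nu> t) \<omega>)"
        by (simp add: scalar_proj_def[abs_def] Let_def)
      with X show ?thesis
        unfolding Let_def
      proof eventually_elim
        case (elim \<omega>)
        show ?case
        proof (intro impI, goal_cases)
          case 1
          note weights = elim(2)[rule_format, OF 1]
          note mixed = dilution_strict[OF conjunct1[OF weights] conjunct1[OF conjunct2[OF weights]]
              conjunct2[OF conjunct2[OF weights]]]
          show ?case
            unfolding elim(1) by (intro conjI impI) (blast dest: mixed | use True in simp)+
        qed
      qed
    next
      case False
      from X show ?thesis
        unfolding Let_def by eventually_elim (use False in \<open>auto simp del: innovation.simps\<close>)
    qed
  qed
qed

end
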